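(* Let $\delta>0$ and $\gamma\ge 0$, let $G$ be the inverse Gaussian subordinator with parameters $(\delta,\gamma)$, let $H(t)=\inf\{u>0: G(u)>t\}$, and let $h(x,t)$ be the density function of $H(t)$, $x>0$. Then $h$ solves $$\frac{\partial^2 h}{\partial x^2}(x,t) - 2\delta\gamma\, \frac{\partial h}{\partial x}(x,t) = 2 \delta^2\, \frac{\partial h}{\partial t}(x,t) +2\delta^2\,h(x,0)\,\delta_{0}(t),$$ where $\delta_0(t)$ is the Dirac delta function.
   Context: Let $B$ be a standard Brownian motion. The inverse Gaussian (IG) subordinator with parameters $(\delta,\gamma)$ is $G(t)=\inf\{s>0: B(s)+\gamma s>\delta t\}$; it is a strictly increasing L\'evy process started at $0$ with $\mathbb{E}\,e^{-sG(x)}=e^{-\delta x(\sqrt{\gamma^2+2s}-\gamma)}$ for $s\ge 0$. Its first-exit time process is $H(t)=\inf\{u>0: G(u)>t\}$, $t\ge 0$, and $h(x,t)$ denotes the density in $x$ of $H(t)$. The term with $\delta_0(t)$ is understood through the Laplace transform in $t$, $\mathcal{L}_t w(x,s)=\int_0^\infty e^{-st}w(x,t)\,dt$, with the conventions $\mathcal{L}_t(\delta_0(t))=1$ and $\mathcal{L}_t(\partial h/\partial t)=s\,\mathcal{L}_t h-h(x,0)$. *)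

theory Defs
  imports "HOL-Probability.Probability"
begin

locale standard_brownian_motion = prob_space M for M :: "'a measure" +
  fixes B :: "real \<Rightarrow> 'a \<Rightarrow> real"
  assumes BM_measurable: "\<And>t. 0 \<le> t \<Longrightarrow> B t \<in> borel_measurable M"
    and BM_start: "AE \<omega> in M. B 0 \<omega> = 0"
    and BM_indep_increments:
      "\<And>(n::nat) (t::nat \<Rightarrow> real). \<lbrakk>0 \<le> t 0; \<And>i. i < n \<Longrightarrow> t i < t (Suc i)\<rbrakk> \<Longrightarrow>
         indep_vars (\<lambda>_. borel) (\<lambda>i \<omega>. B (t (Suc i)) \<omega> - B (t i) \<omega>) {..<n}"
    and BM_normal_increments:
      "\<And>s t. \<lbrakk>0 \<le> s; s < t\<rbrakk> \<Longrightarrow>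
         distributed M lborel (\<lambda>\<omega>. B t \<omega> - B s \<omega>) (\<lambda>x. ennreal (normal_density 0 (sqrt (t - s)) x))"
    and BM_continuous: "\<And>\<omega>. \<omega> \<in> space M \<Longrightarrow> continuous_on {0..} (\<lambda>t. B t \<omega>)"

(* For delta > 0 and gamma >= 0 one has sup_s (B(s) + gamma s) = infinity almost surely; on that
   event the sets below are nonempty for all t >= 0 and bounded below by 0, so the infima in the
   reals are the intended ones. On the complement, a null set, their values are irrelevant. *)
definition ig_subordinator ::
  "(real \<Rightarrow> 'a \<Rightarrow> real) \<Rightarrow> real \<Rightarrow> real \<Rightarrow> real \<Rightarrow> 'a \<Rightarrow> real" where
  "ig_subordinator B \<delta> \<gamma> t \<omega> = Inf {s. 0 < s \<and> B s \<omega> + \<gamma> * s > \<delta> * t}"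

definition first_exit_time :: "(real \<Rightarrow> 'a \<Rightarrow> real) \<Rightarrow> real \<Rightarrow> 'a \<Rightarrow> real" where
  "first_exit_time G t \<omega> = Inf {u. 0 < u \<and> G u \<omega> > t}"

(* The continuous version of the density, on the open half-line, of the law of X. Continuity
   singles out one representative, so that pointwise derivatives are meaningful. Only the part of
   the law on (0, infinity) is described, so that t = 0 is covered as well: H(0) = 0 almost surely,
   and the density h(., 0) on (0, infinity) is the zero function. *)
definition has_continuous_density_pos :: "'a measure \<Rightarrow> ('a \<Rightarrow> real) \<Rightarrow> (real \<Rightarrow> real) \<Rightarrow> bool" where
  "has_continuous_density_pos M X f \<longleftrightarrow>
     X \<in> borel_measurable M \<and>
     continuous_on {0<..} f \<and> (\<forall>x>0. 0 \<le> f x) \<and>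
     (\<forall>A\<in>sets borel. A \<subseteq> {0<..} \<longrightarrow>
        emeasure M {\<omega>\<in>space M. X \<omega> \<in> A} = (\<integral>\<^sup>+x\<in>A. ennreal (f x) \<partial>lborel))"

definition partial_x :: "(real \<Rightarrow> real \<Rightarrow> real) \<Rightarrow> real \<Rightarrow> real \<Rightarrow> real" where
  "partial_x h x t = deriv (\<lambda>y. h y t) x"

definition partial_t :: "(real \<Rightarrow> real \<Rightarrow> real) \<Rightarrow> real \<Rightarrow> real \<Rightarrow> real" where
  "partial_t h x t = deriv (\<lambda>u. h x u) t"

definition laplace_converges :: "(real \<Rightarrow> real) \<Rightarrow> real \<Rightarrow> bool" where
  "laplace_converges w s \<longleftrightarrow> set_integrable lborel {0..} (\<lambda>t. exp (- s * t) * w t)"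

definition laplace :: "(real \<Rightarrow> real) \<Rightarrow> real \<Rightarrow> real" where
  "laplace w s = (LBINT t:{0..}. exp (- s * t) * w t)"

(* Laplace transform of the Dirac delta at 0, viewed as a unit point mass; its value is 1, see
   the lemma below. *)
definition laplace_dirac0 :: "real \<Rightarrow> real" where
  "laplace_dirac0 s = (LINT t:{0..}|return borel (0::real). exp (- s * t))"

lemma laplace_dirac0_eq_1: "laplace_dirac0 s = 1"
  unfolding laplace_dirac0_def set_lebesgue_integral_def
  by (subst integral_return) auto

end

theory Submission
  imports Defs "HOL-Real_Asymp.Real_Asymp"
begin

text \<open>
  The first-exit time is a running maximum: G(u) is the first time at which the path
  B(s) + \<gamma> s climbs above \<delta> u, so H(t) > x holds exactly when the path exceeds \<delta> x
  during [0, t] (\<open>first_exit_time_gt_iff\<close>). Everything therefore rests on the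
  Bachelier-Levy formula for the running maximum of a Brownian motion with drift,

    P(max over [0, t] > a) = Q((a - \<gamma> t) / sqrt t) + exp(2 \<gamma> a) Q((a + \<gamma> t) / sqrt t),

  where Q is the standard normal tail (\<open>emeasure_passage\<close>).

  The formula is obtained from finite-dimensional distributions by a reflection argument in
  discrete time. Consider the payoff that
  equals 1 + exp(-2 \<gamma> (w - a)) for w > a and 0 for w \<le> a. Its mean V(r, y), when the motion
  starts at y and runs for time r, is at least 1 for y > a and at most 1 for y \<le> a: reflecting
  the Gaussian density at a turns the exponential weight into a factor that is \<ge> 1 or \<le> 1
  according to the side of a on which y lies (\<open>payoff_mean_reflect\<close>). By the semigroup
  property, V is a martingale along the motion sampled on a grid. Stopping it when the
  sampled motion first exceeds a bounds the passage probability from above by V(t, 0)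
  (\<open>crossing_prob_le\<close>). With the barrier raised to a + \<epsilon> the same martingale is at most 1 at the
  stopping step unless that step jumps by more than \<epsilon>, which gives the matching lower bound
  (\<open>crossing_prob_ge\<close>). The jump term vanishes as the grid is refined, path continuity passes from
  dyadic grids to [0, t], and then \<epsilon> tends to 0. Evaluating V(t, 0) gives the two tails.

  A continuous density of H(t) must be minus the derivative of x \<mapsto> P(H(t) > x), so for t > 0 it
  is an explicit combination of a Gaussian kernel k and an exponentially tilted tail E whose
  derivatives are again combinations of k and E; the differential equation is then algebra. At
  t = 0 the density vanishes on the positive half-line since H(0) = 0 almost surely, which makes the
  Dirac term zero. For fixed x > 0 the kernel k decays faster than t^2 as t tends to 0, so the
  density and its derivatives are bounded in t, all Laplace transforms converge, and the transform
  of the time derivative is an integration by parts.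
\<close>

section \<open>Exit times of a continuous path\<close>

text \<open>The infimum defining the passage level of u only registers strict exceedance of \<delta> u, so it can be
  equal to t for the one level that is exactly the maximum over [0, t]. The set of levels whose passage
  happens after t is therefore known only up to its endpoint, which does not change its infimum, the
  maximum divided by \<delta>.\<close>
lemma first_exit_time_gt_iff:
  fixes X :: "real \<Rightarrow> real"
  assumes \<delta>: "\<delta> > 0" and cont: "continuous_on {0..} X" and X0: "X 0 = 0"
    and unb: "\<And>u. u > 0 \<Longrightarrow> \<exists>s>0. X s > \<delta> * u" and t: "t \<ge> 0" and x: "x > 0"
  shows "Inf {u. 0 < u \<and> Inf {s. 0 < s \<and> X s > \<delta> * u} > t} > x \<longleftrightarrow> (\<exists>s\<in>{0..t}. X s > \<delta> * x)"
proof -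
  define g where "g u = Inf {s. 0 < s \<and> X s > \<delta> * u}" for u
  define U where "U = {u. 0 < u \<and> g u > t}"
  have le: "g u \<le> t" if "u > 0" "s \<in> {0..t}" "X s > \<delta> * u" for u s
  proof -
    have "s \<noteq> 0" using that X0 \<delta> by (metis mult_pos_pos order_less_asym)
    then have "g u \<le> s" unfolding g_def using that
      by (intro cInf_lower bdd_belowI[of _ 0]) auto
    then show ?thesis using that by auto
  qed
  \<comment> \<open>The maximum over [0, t] is strictly below the level, and continuity at t keeps the path below
    the level for a little longer.\<close>
  have gt: "g u > t" if u: "u > 0" and below: "\<And>s. s \<in> {0..t} \<Longrightarrow> X s < \<delta> * u" for u
  proof -
    \<comment> \<open>Truncating the argument extends the path continuously to negative times, so that full
      neighbourhoods of t can be used also for t = 0.\<close>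
    have "continuous_on UNIV (\<lambda>s. X (max 0 s))"
      by (rule continuous_on_compose2[OF cont]) (auto intro!: continuous_on_max continuous_on_const continuous_on_id)
    then have "isCont (\<lambda>s. X (max 0 s)) t" by (simp add: continuous_on_eq_continuous_at)
    then have "((\<lambda>s. X (max 0 s)) \<longlongrightarrow> X (max 0 t)) (nhds t)"
      using tendsto_at_iff_tendsto_nhds[of "\<lambda>s. X (max 0 s)" t] by (simp add: isCont_def)
    moreover have "X (max 0 t) < \<delta> * u" using below[of t] t by auto
    ultimately have "eventually (\<lambda>s. X (max 0 s) < \<delta> * u) (nhds t)"
      by (rule order_tendstoD(2))
    then obtain e where e: "e > 0" "\<And>s. dist s t < e \<Longrightarrow> X (max 0 s) < \<delta> * u"
      by (auto simp: eventually_nhds_metric)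
    have "t + e \<le> g u" unfolding g_def
    proof (rule cInf_greatest)
      show "{s. 0 < s \<and> \<delta> * u < X s} \<noteq> {}" using unb[OF u] by auto
      fix s assume s: "s \<in> {s. 0 < s \<and> \<delta> * u < X s}"
      show "t + e \<le> s"
      proof (rule ccontr)
        assume "\<not> t + e \<le> s"
        then have "s \<le> t \<or> dist s t < e" by (auto simp: dist_real_def)
        then show False using below[of s] e(2)[of s] s by (auto simp: max_def split: if_splits)
      qed
    qed
    then show ?thesis using e by simp
  qed
  have bdd: "bdd_below U" unfolding U_def by (intro bdd_belowI[of _ 0]) auto
  have "compact (X ` {0..t})"
    by (intro compact_continuous_image continuous_on_subset[OF cont]) auto
  then have "bdd_above (X ` {0..t})" by (simp add: bounded_imp_bdd_above compact_imp_bounded)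
  then obtain K where K: "\<And>s. s \<in> {0..t} \<Longrightarrow> X s \<le> K"
    unfolding bdd_above_def by blast
  have "\<bar>K\<bar> / \<delta> + 1 \<in> U"
    unfolding U_def
  proof (intro CollectI conjI gt)
    show "\<bar>K\<bar> / \<delta> + 1 > 0" "\<bar>K\<bar> / \<delta> + 1 > 0" using \<delta> by (auto simp: add_nonneg_pos)
    show "X s < \<delta> * (\<bar>K\<bar> / \<delta> + 1)" if "s \<in> {0..t}" for s
    proof -
      have "\<delta> * (\<bar>K\<bar> / \<delta> + 1) = \<bar>K\<bar> + \<delta>" using \<delta> by (simp add: field_simps)
      then show ?thesis using K[OF that] \<delta> by linarith
    qed
  qed
  then have ne: "U \<noteq> {}" by auto
  have "Inf U > x \<longleftrightarrow> (\<exists>s\<in>{0..t}. X s > \<delta> * x)"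
  proof
    assume "\<exists>s\<in>{0..t}. X s > \<delta> * x"
    then obtain s where s: "s \<in> {0..t}" "X s > \<delta> * x" by auto
    obtain y where y: "x < y" "y < X s / \<delta>"
      using s \<delta> dense[of x "X s / \<delta>"] by (auto simp: field_simps)
    have "y \<le> Inf U"
    proof (rule cInf_greatest[OF ne], rule ccontr)
      fix u assume u: "u \<in> U" "\<not> y \<le> u"
      then have "u < X s / \<delta>" using y by auto
      then have "\<delta> * u < X s" using \<delta> by (simp add: field_simps)
      then show False using le[of u s] u s by (auto simp: U_def)
    qed
    then show "x < Inf U" using y by simp
  next
    assume *: "x < Inf U"
    show "\<exists>s\<in>{0..t}. X s > \<delta> * x"
    proof (rule ccontr)
      assume "\<not> (\<exists>s\<in>{0..t}. X s > \<delta> * x)"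
      then have all: "X s \<le> \<delta> * x" if "s \<in> {0..t}" for s using that by force
      obtain y where y: "x < y" "y < Inf U" using * dense by blast
      have "X s < \<delta> * y" if "s \<in> {0..t}" for s
        using all[OF that] y \<delta> by (meson le_less_trans mult_strict_left_mono)
      then have "y \<in> U" using y x gt[of y] by (auto simp: U_def)
      then show False using cInf_lower[OF _ bdd] y by force
    qed
  qed
  then show ?thesis by (simp add: U_def g_def)
qed

section \<open>Gaussian tails\<close>

definition gauss_tail :: "real \<Rightarrow> real" where
  "gauss_tail z = (LBINT w:{z<..}. std_normal_density w)"

lemma set_integrable_std_normal: "A \<in> sets borel \<Longrightarrow> set_integrable lborel A std_normal_density"
  unfolding set_integrable_def
  using integrable_real_mult_indicator[of A lborel std_normal_density] by (simp add: mult.commute)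

lemma nn_integral_gauss_tail:
  "(\<integral>\<^sup>+w. indicator {z<..} w * ennreal (std_normal_density w) \<partial>lborel) = ennreal (gauss_tail z)"
proof -
  have "(\<integral>\<^sup>+w. indicator {z<..} w * ennreal (std_normal_density w) \<partial>lborel)
     = (\<integral>\<^sup>+w. ennreal (indicator {z<..} w *\<^sub>R std_normal_density w) \<partial>lborel)"
    by (intro nn_integral_cong) (auto simp: indicator_def)
  also have "\<dots> = ennreal (gauss_tail z)"
    unfolding gauss_tail_def set_lebesgue_integral_def
    using set_integrable_std_normal[of "{z<..}"]
    by (intro nn_integral_eq_integral) (auto simp: set_integrable_def)
  finally show ?thesis .
qed

lemma gauss_tail_nonneg: "0 \<le> gauss_tail z"
  unfolding gauss_tail_def set_lebesgue_integral_def by (intro Bochner_Integration.integral_nonneg) auto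

lemma nn_integral_normal_density:
  "\<sigma> > 0 \<Longrightarrow> (\<integral>\<^sup>+w. ennreal (normal_density \<mu> \<sigma> w) \<partial>lborel) = 1"
  using integral_normal_density[of \<sigma> \<mu>] by (subst nn_integral_eq_integral) auto

text \<open>The substitution w = \<mu> + \<sigma> z.\<close>
lemma nn_integral_normal_tail:
  assumes "\<sigma> > 0"
  shows "(\<integral>\<^sup>+w. indicator {a<..} w * ennreal (normal_density \<mu> \<sigma> w) \<partial>lborel) = ennreal (gauss_tail ((a - \<mu>) / \<sigma>))"
proof -
  have nd: "\<sigma> * normal_density \<mu> \<sigma> (\<mu> + \<sigma> * z) = std_normal_density z" for z
    using assms by (simp add: normal_density_def power_mult_distrib real_sqrt_mult)
  have "(\<integral>\<^sup>+w. indicator {a<..} w * ennreal (normal_density \<mu> \<sigma> w) \<partial>lborel)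
     = ennreal \<sigma> * (\<integral>\<^sup>+z. indicator {a<..} (\<mu> + \<sigma> * z) * ennreal (normal_density \<mu> \<sigma> (\<mu> + \<sigma> * z)) \<partial>lborel)"
    using assms by (subst nn_integral_real_affine[where c=\<sigma> and t=\<mu>]) auto
  also have "\<dots> = (\<integral>\<^sup>+z. indicator {(a - \<mu>) / \<sigma><..} z * ennreal (std_normal_density z) \<partial>lborel)"
    using assms
    by (subst nn_integral_cmult[symmetric])
       (auto intro!: nn_integral_cong simp: nd[symmetric] ennreal_mult indicator_def field_simps)
  finally show ?thesis by (simp add: nn_integral_gauss_tail)
qed

lemma has_real_derivative_gauss_tail: "(gauss_tail has_real_derivative - std_normal_density z) (at z)"
proof -
  have cont: "continuous_on A std_normal_density" for A
    unfolding std_normal_density_def by (intro continuous_intros) auto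
  have split: "gauss_tail y = gauss_tail (z - 1) - integral {z - 1..y} std_normal_density"
    if "y \<in> {z-1..z+1}" for y
  proof -
    have "gauss_tail (z - 1) = (LBINT w:{z-1<..y} \<union> {y<..}. std_normal_density w)"
      unfolding gauss_tail_def using that by (intro arg_cong2[where f="set_lebesgue_integral lborel"]) auto
    also have "\<dots> = (LBINT w:{z-1<..y}. std_normal_density w) + gauss_tail y"
      unfolding gauss_tail_def by (rule set_integral_Un) (auto intro: set_integrable_std_normal)
    also have "(LBINT w:{z-1<..y}. std_normal_density w) = (LBINT w:{z-1..y}. std_normal_density w)"
      by (rule set_integral_cong_set)
         (auto simp: set_borel_measurable_def intro!: AE_I'[of "{z-1}"])
    also have "\<dots> = integral {z-1..y} std_normal_density"
      by (rule set_borel_integral_eq_integral) (rule set_integrable_std_normal, simp)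
    finally show ?thesis by simp
  qed
  have "((\<lambda>y. integral {z - 1..y} std_normal_density) has_real_derivative std_normal_density z) (at z within {z-1..z+1})"
    by (rule integral_has_real_derivative[OF cont]) auto
  then have "((\<lambda>y. integral {z - 1..y} std_normal_density) has_real_derivative std_normal_density z) (at z)"
    by (simp add: at_within_Icc_at)
  then have "((\<lambda>y. gauss_tail (z - 1) - integral {z - 1..y} std_normal_density) has_real_derivative 0 - std_normal_density z) (at z)"
    by (intro derivative_intros)
  moreover have "eventually (\<lambda>y. y \<in> {z-1<..<z+1}) (nhds z)"
    by (intro eventually_nhds_in_open) auto
  then have "eventually (\<lambda>y. gauss_tail y = gauss_tail (z - 1) - integral {z - 1..y} std_normal_density) (nhds z)"
    by eventually_elim (rule split, auto)
  ultimately show ?thesis by (subst DERIV_cong_ev[OF refl _ refl]) auto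
qed

lemma gauss_tail_add_neg: "gauss_tail z + gauss_tail (- z) = 1"
proof -
  have "ennreal (gauss_tail z) + ennreal (gauss_tail (- z)) = 
     (\<integral>\<^sup>+w. indicator {z<..} w * ennreal (std_normal_density w) \<partial>lborel)
     + (\<integral>\<^sup>+w. indicator {-z<..} w * ennreal (std_normal_density w) \<partial>lborel)"
    by (simp add: nn_integral_gauss_tail)
  also have "(\<integral>\<^sup>+w. indicator {-z<..} w * ennreal (std_normal_density w) \<partial>lborel)
     = (\<integral>\<^sup>+w. indicator {..<z} w * ennreal (std_normal_density w) \<partial>lborel)"
    by (subst nn_integral_real_affine[where c="-1" and t=0]) 
       (auto intro!: nn_integral_cong simp: indicator_def std_normal_density_def)
  also have "(\<integral>\<^sup>+w. indicator {z<..} w * ennreal (std_normal_density w) \<partial>lborel) + \<dots>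
     = (\<integral>\<^sup>+w. indicator {z<..} w * ennreal (std_normal_density w) + indicator {..<z} w * ennreal (std_normal_density w) \<partial>lborel)"
    by (subst nn_integral_add) auto
  also have "\<dots> = (\<integral>\<^sup>+w. ennreal (std_normal_density w) \<partial>lborel)"
    using AE_lborel_singleton[of z] by (intro nn_integral_cong_AE) (auto simp: indicator_def)
  finally have "ennreal (gauss_tail z + gauss_tail (- z)) = ennreal 1"
    by (simp add: nn_integral_normal_density gauss_tail_nonneg)
  moreover have "0 \<le> gauss_tail z + gauss_tail (- z)"
    by (intro add_nonneg_nonneg gauss_tail_nonneg)
  ultimately show ?thesis using ennreal_inj[OF _ zero_le_one] by blast
qed

lemma gauss_tail_0: "gauss_tail 0 = 1 / 2"
  using gauss_tail_add_neg[of 0] by simp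

lemma gauss_tail_le_1: "gauss_tail z \<le> 1"
  using gauss_tail_add_neg[of z] gauss_tail_nonneg[of "-z"] by linarith

text \<open>Exponential Markov inequality; completing the square turns the weighted density into a
  normal density with shifted mean.\<close>
lemma normal_tail_chernoff:
  assumes "\<sigma> > 0" "l \<ge> 0"
  shows "emeasure (density lborel (\<lambda>z. ennreal (normal_density \<mu> \<sigma> z))) {\<epsilon><..} \<le> ennreal (exp (- l * \<epsilon> + l * \<mu> + l\<^sup>2 * \<sigma>\<^sup>2 / 2))"
proof -
  have nd: "exp (l * (w - \<epsilon>)) * normal_density \<mu> \<sigma> w 
     = exp (- l * \<epsilon> + l * \<mu> + l\<^sup>2 * \<sigma>\<^sup>2 / 2) * normal_density (\<mu> + l * \<sigma>\<^sup>2) \<sigma> w" for w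
  proof -
    have "l * (w - \<epsilon>) + (- (w - \<mu>)\<^sup>2 / (2 * \<sigma>\<^sup>2))
       = (- l * \<epsilon> + l * \<mu> + l\<^sup>2 * \<sigma>\<^sup>2 / 2) + (- (w - (\<mu> + l * \<sigma>\<^sup>2))\<^sup>2 / (2 * \<sigma>\<^sup>2))"
      using assms by (simp add: divide_simps) (simp add: power2_eq_square algebra_simps)
    then have "exp (l * (w - \<epsilon>)) * exp (- (w - \<mu>)\<^sup>2 / (2 * \<sigma>\<^sup>2))
       = exp (- l * \<epsilon> + l * \<mu> + l\<^sup>2 * \<sigma>\<^sup>2 / 2) * exp (- (w - (\<mu> + l * \<sigma>\<^sup>2))\<^sup>2 / (2 * \<sigma>\<^sup>2))"
      by (simp only: exp_add[symmetric])
    then show ?thesis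
      unfolding normal_density_def by (simp only: mult.left_commute[of "exp _"])
  qed
  have "emeasure (density lborel (\<lambda>z. ennreal (normal_density \<mu> \<sigma> z))) {\<epsilon><..}
     = (\<integral>\<^sup>+w. ennreal (normal_density \<mu> \<sigma> w) * indicator {\<epsilon><..} w \<partial>lborel)"
    by (subst emeasure_density) auto
  also have "\<dots> \<le> (\<integral>\<^sup>+w. ennreal (exp (l * (w - \<epsilon>)) * normal_density \<mu> \<sigma> w) \<partial>lborel)"
  proof (intro nn_integral_mono)
    fix w
    show "ennreal (normal_density \<mu> \<sigma> w) * indicator {\<epsilon><..} w \<le> ennreal (exp (l * (w - \<epsilon>)) * normal_density \<mu> \<sigma> w)"
    proof (cases "\<epsilon> < w")
      case True
      then have "1 \<le> exp (l * (w - \<epsilon>))" using assms by simp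
      then have "1 * normal_density \<mu> \<sigma> w \<le> exp (l * (w - \<epsilon>)) * normal_density \<mu> \<sigma> w"
        by (intro mult_right_mono) auto
      then show ?thesis using True by (simp add: ennreal_leI)
    qed simp
  qed
  also have "\<dots> = ennreal (exp (- l * \<epsilon> + l * \<mu> + l\<^sup>2 * \<sigma>\<^sup>2 / 2))"
    unfolding nd using assms
    by (simp add: ennreal_mult nn_integral_cmult nn_integral_normal_density)
  finally show ?thesis .
qed

text \<open>A union bound for the event that one of the n increments over [0, t] exceeds \<epsilon>; the factor 2
  is an upper bound for the payoff on that event.\<close>
lemma max_increment_negligible:
  assumes t: "t > 0" and \<epsilon>: "\<epsilon> > 0"
  shows "(\<lambda>n. of_nat n * (2 * emeasure (density lborel (\<lambda>z. ennreal (normal_density (\<gamma> * (t / real n)) (sqrt (t / real n)) z))) {\<epsilon><..}))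
     \<longlonglongrightarrow> 0"
proof -
  \<comment> \<open>The Chernoff parameter sqrt n balances the terms: the drift contributes a vanishing amount, the
    variance t / 2, and the level - \<epsilon> sqrt n, which beats the factor n.\<close>
  have "((\<lambda>x::real. x * (2 * exp (- sqrt x * \<epsilon> + sqrt x * (\<gamma> * (t / x)) + t / 2))) \<longlongrightarrow> 0) at_top"
    using t \<epsilon> by real_asymp
  then have "(\<lambda>n. real n * (2 * exp (- sqrt n * \<epsilon> + sqrt n * (\<gamma> * (t / n)) + t / 2))) \<longlonglongrightarrow> 0"
    by (rule filterlim_compose[OF _ filterlim_real_sequentially])
  then have lim: "(\<lambda>n. ennreal (real n * (2 * exp (- sqrt n * \<epsilon> + sqrt n * (\<gamma> * (t / n)) + t / 2)))) \<longlonglongrightarrow> 0"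
    using tendsto_ennrealI[of _ 0] by simp
  have "\<forall>\<^sub>F n in sequentially. of_nat n * (2 * emeasure (density lborel (\<lambda>z. ennreal (normal_density (\<gamma> * (t / real n)) (sqrt (t / real n)) z))) {\<epsilon><..})
    \<le> ennreal (real n * (2 * exp (- sqrt n * \<epsilon> + sqrt n * (\<gamma> * (t / n)) + t / 2)))"
    using eventually_gt_at_top[of 0]
  proof eventually_elim
    fix n :: nat assume n: "0 < n"
    have "(sqrt n)\<^sup>2 * (sqrt (t / n))\<^sup>2 / 2 = t / 2" using t n by simp
    then have "emeasure (density lborel (\<lambda>z. ennreal (normal_density (\<gamma> * (t / real n)) (sqrt (t / real n)) z))) {\<epsilon><..}
      \<le> ennreal (exp (- sqrt n * \<epsilon> + sqrt n * (\<gamma> * (t / n)) + t / 2))"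
      using normal_tail_chernoff[of "sqrt (t / n)" "sqrt n" "\<gamma> * (t / n)" \<epsilon>] n t by simp
    then show "of_nat n * (2 * emeasure (density lborel (\<lambda>z. ennreal (normal_density (\<gamma> * (t / real n)) (sqrt (t / real n)) z))) {\<epsilon><..})
    \<le> ennreal (real n * (2 * exp (- sqrt n * \<epsilon> + sqrt n * (\<gamma> * (t / n)) + t / 2)))"
      by (simp add: ennreal_mult ennreal_of_nat_eq_real_of_nat mult_left_mono)
  qed
  then show ?thesis by (intro tendsto_sandwich[where f="\<lambda>_. 0", OF _ _ tendsto_const lim]) auto
qed

lemma isCont_gauss_tail: "isCont gauss_tail z"
  using has_real_derivative_gauss_tail DERIV_isCont by blast

lemma gauss_tail_at_top: "(gauss_tail \<longlongrightarrow> 0) at_top"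
proof -
  have bound: "gauss_tail z \<le> exp (- z + 1 / 2)" for z
  proof -
    have "ennreal (gauss_tail z) = emeasure (density lborel (\<lambda>w. ennreal (normal_density 0 1 w))) {z<..}"
      by (subst emeasure_density) (auto simp: nn_integral_gauss_tail[symmetric] mult.commute)
    also have "\<dots> \<le> ennreal (exp (- z + 1 / 2))"
      using normal_tail_chernoff[of 1 1 0 z] by simp
    finally show ?thesis by (simp add: ennreal_le_iff)
  qed
  show ?thesis
  proof (rule tendsto_sandwich[where f="\<lambda>_. 0" and h="\<lambda>z. exp (- z + 1 / 2)"])
    show "((\<lambda>z::real. exp (- z + 1 / 2)) \<longlongrightarrow> 0) at_top" by real_asymp
    show "\<forall>\<^sub>F z in at_top. 0 \<le> gauss_tail z" by (simp add: gauss_tail_nonneg)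
    show "\<forall>\<^sub>F z in at_top. gauss_tail z \<le> exp (- z + 1 / 2)" using bound by (intro always_eventually allI)
  qed simp
qed

section \<open>A payoff reflected at the barrier\<close>

text \<open>The Bachelier-Levy expression for the probability that a Brownian motion with drift \<gamma> exceeds
  the level a before time t.\<close>
definition passage_prob :: "real \<Rightarrow> real \<Rightarrow> real \<Rightarrow> real" where
  "passage_prob \<gamma> a t = gauss_tail ((a - \<gamma> * t) / sqrt t) + exp (2 * \<gamma> * a) * gauss_tail ((a + \<gamma> * t) / sqrt t)"

lemma isCont_passage_prob: "t > 0 \<Longrightarrow> isCont (\<lambda>a. passage_prob \<gamma> a t) a"
  unfolding passage_prob_def
  by (intro continuous_intros isCont_o2[OF _ isCont_gauss_tail]) auto

text \<open>Without drift the expression is twice the tail at a / sqrt t, and the tail at 0 is 1 / 2. This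
  yields that Brownian motion is unbounded above.\<close>
lemma passage_prob_no_drift_tendsto: "(\<lambda>n. passage_prob 0 a (real (Suc n))) \<longlonglongrightarrow> 1"
proof -
  have "((\<lambda>x::real. a / sqrt (1 + x)) \<longlongrightarrow> 0) at_top" by real_asymp
  then have "(\<lambda>n. a / sqrt (1 + real n)) \<longlonglongrightarrow> 0"
    by (rule filterlim_compose[OF _ filterlim_real_sequentially])
  then have "(\<lambda>n. gauss_tail (a / sqrt (1 + real n))) \<longlonglongrightarrow> gauss_tail 0"
    using isCont_tendsto_compose[OF isCont_gauss_tail] by blast
  from tendsto_add[OF this this] show ?thesis by (simp add: passage_prob_def gauss_tail_0)
qed

text \<open>The part 1 pays for ending above the barrier; the exponential part, seen through the reflection at
  the barrier, pays for having crossed it and ending below.\<close>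
definition payoff :: "real \<Rightarrow> real \<Rightarrow> real \<Rightarrow> ennreal" where
  "payoff \<gamma> a w = indicator {a<..} w * ennreal (1 + exp (- 2 * \<gamma> * (w - a)))"

text \<open>The mean payoff after time r when the motion with drift \<gamma> starts at y. The normal density
  with standard deviation 0 is identically 0 rather than a point mass, hence the separate case r = 0.\<close>
definition payoff_mean :: "real \<Rightarrow> real \<Rightarrow> real \<Rightarrow> real \<Rightarrow> ennreal" where
  "payoff_mean \<gamma> a r y = (if r = 0 then payoff \<gamma> a y else
     (\<integral>\<^sup>+w. payoff \<gamma> a w * ennreal (normal_density (y + \<gamma> * r) (sqrt r) w) \<partial>lborel))"

lemma payoff_measurable [measurable]: "payoff \<gamma> a \<in> borel_measurable borel"
  unfolding payoff_def by measurable

lemma normal_density_pair_measurable [measurable]: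
  assumes "f \<in> borel_measurable M" "g \<in> borel_measurable M"
  shows "(\<lambda>x. normal_density (f x) \<sigma> (g x)) \<in> borel_measurable M"
  using assms unfolding normal_density_def by measurable

lemma payoff_mean_measurable [measurable]: "payoff_mean \<gamma> a r \<in> borel_measurable borel"
proof (cases "r = 0")
  case True then show ?thesis by (simp add: payoff_mean_def[abs_def])
next
  case False
  then show ?thesis unfolding payoff_mean_def[abs_def] by simp
qed

text \<open>The semigroup property, which makes the mean payoff a martingale along the walk with normal steps:
  the variances r and d add up under convolution.\<close>
lemma payoff_mean_add:
  assumes r: "r \<ge> 0" and d: "d > 0"
  shows "payoff_mean \<gamma> a (r + d) y 
    = (\<integral>\<^sup>+z. payoff_mean \<gamma> a r (y + z) \<partial>density lborel (\<lambda>z. ennreal (normal_density (\<gamma> * d) (sqrt d) z)))"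
proof (cases "r = 0")
  case True
  have "(\<integral>\<^sup>+z. payoff \<gamma> a (y + z) \<partial>density lborel (\<lambda>z. ennreal (normal_density (\<gamma> * d) (sqrt d) z)))
    = (\<integral>\<^sup>+z. ennreal (normal_density (\<gamma> * d) (sqrt d) z) * payoff \<gamma> a (y + z) \<partial>lborel)"
    by (subst nn_integral_density) auto
  also have "\<dots> = (\<integral>\<^sup>+w. payoff \<gamma> a w * ennreal (normal_density (y + \<gamma> * d) (sqrt d) w) \<partial>lborel)"
    by (subst (2) nn_integral_real_affine[where c=1 and t=y]) 
       (auto intro!: nn_integral_cong simp: normal_density_def mult.commute algebra_simps)
  finally show ?thesis using True d by (simp add: payoff_mean_def)
next
  case False
  then have r: "r > 0" using r by simp
  have conv: "(\<integral>\<^sup>+z. ennreal (normal_density (\<gamma> * d) (sqrt d) z) * ennreal (normal_density (y + z + \<gamma> * r) (sqrt r) w) \<partial>lborel)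
     = ennreal (normal_density (y + \<gamma> * (r + d)) (sqrt (r + d)) w)" for w
  proof -
    have "(\<integral>\<^sup>+z. ennreal (normal_density (\<gamma> * d) (sqrt d) z) * ennreal (normal_density (y + z + \<gamma> * r) (sqrt r) w) \<partial>lborel)
      = (\<integral>\<^sup>+z. ennreal (normal_density 0 (sqrt r) ((w - y - \<gamma> * (r + d)) - z) * normal_density 0 (sqrt d) z) \<partial>lborel)"
      by (subst nn_integral_real_affine[where c=1 and t="\<gamma> * d"])
         (auto intro!: nn_integral_cong simp: normal_density_def ennreal_mult[symmetric] algebra_simps)
    also have "\<dots> = ennreal (normal_density 0 (sqrt (r + d)) (w - y - \<gamma> * (r + d)))"
      using fun_cong[OF conv_normal_density_zero_mean[of "sqrt r" "sqrt d"], of "w - y - \<gamma> * (r + d)"] r d by simp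
    finally show ?thesis by (simp add: normal_density_def algebra_simps)
  qed
  have "(\<integral>\<^sup>+z. payoff_mean \<gamma> a r (y + z) \<partial>density lborel (\<lambda>z. ennreal (normal_density (\<gamma> * d) (sqrt d) z)))
    = (\<integral>\<^sup>+z. ennreal (normal_density (\<gamma> * d) (sqrt d) z) * payoff_mean \<gamma> a r (y + z) \<partial>lborel)"
    by (subst nn_integral_density) auto
  also have "\<dots> = (\<integral>\<^sup>+z. (\<integral>\<^sup>+w. ennreal (normal_density (\<gamma> * d) (sqrt d) z) * 
      (payoff \<gamma> a w * ennreal (normal_density (y + z + \<gamma> * r) (sqrt r) w)) \<partial>lborel) \<partial>lborel)"
    using r by (simp add: payoff_mean_def nn_integral_cmult)
  also have "\<dots> = (\<integral>\<^sup>+w. (\<integral>\<^sup>+z. ennreal (normal_density (\<gamma> * d) (sqrt d) z) * 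
      (payoff \<gamma> a w * ennreal (normal_density (y + z + \<gamma> * r) (sqrt r) w)) \<partial>lborel) \<partial>lborel)"
    by (rule lborel_pair.Fubini') measurable
  also have "\<dots> = (\<integral>\<^sup>+w. payoff \<gamma> a w * (\<integral>\<^sup>+z. ennreal (normal_density (\<gamma> * d) (sqrt d) z) * 
      ennreal (normal_density (y + z + \<gamma> * r) (sqrt r) w) \<partial>lborel) \<partial>lborel)"
    by (subst nn_integral_cmult[symmetric]) (auto intro!: nn_integral_cong simp: ac_simps)
  also have "\<dots> = payoff_mean \<gamma> a (r + d) y"
    unfolding conv using r d by (simp add: payoff_mean_def)
  finally show ?thesis by simp
qed

text \<open>Substituting w \<mapsto> 2 a - w in the exponential part of the payoff moves it to the half-line
  below a; the drift contributions to the two exponents cancel and leave the crossing probability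
  exp(-2 (a - w) (a - y) / r) of a Brownian bridge from y to w.\<close>
lemma payoff_mean_reflect:
  assumes r: "r > 0"
  shows "payoff_mean \<gamma> a r y = (\<integral>\<^sup>+w. ennreal (normal_density (y + \<gamma> * r) (sqrt r) w) *
     (indicator {a<..} w + indicator {..<a} w * ennreal (exp (- 2 * (a - w) * (a - y) / r))) \<partial>lborel)"
proof -
  let ?n = "normal_density (y + \<gamma> * r) (sqrt r)"
  have nd: "exp (- 2 * \<gamma> * (a - w)) * ?n (2 * a - w) = ?n w * exp (- 2 * (a - w) * (a - y) / r)" for w
  proof -
    have "- 2 * \<gamma> * (a - w) + (- (2 * a - w - (y + \<gamma> * r))\<^sup>2 / (2 * r))
        = - (w - (y + \<gamma> * r))\<^sup>2 / (2 * r) + - 2 * (a - w) * (a - y) / r"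
      using r by (simp add: divide_simps) (simp add: power2_eq_square algebra_simps)
    then have "exp (- 2 * \<gamma> * (a - w)) * exp (- (2 * a - w - (y + \<gamma> * r))\<^sup>2 / (2 * r))
        = exp (- (w - (y + \<gamma> * r))\<^sup>2 / (2 * r)) * exp (- 2 * (a - w) * (a - y) / r)"
      by (simp only: exp_add[symmetric])
    then show ?thesis using r unfolding normal_density_def by simp
  qed
  have "payoff_mean \<gamma> a r y = (\<integral>\<^sup>+w. ennreal (?n w) * indicator {a<..} w +
      indicator {a<..} w * ennreal (exp (- 2 * \<gamma> * (w - a)) * ?n w) \<partial>lborel)"
    using r unfolding payoff_mean_def payoff_def
    by (auto intro!: nn_integral_cong simp: indicator_def ennreal_mult[symmetric] ennreal_plus[symmetric] algebra_simps simp del: ennreal_plus)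
  also have "\<dots> = (\<integral>\<^sup>+w. ennreal (?n w) * indicator {a<..} w \<partial>lborel) +
      (\<integral>\<^sup>+w. indicator {a<..} w * ennreal (exp (- 2 * \<gamma> * (w - a)) * ?n w) \<partial>lborel)"
    by (rule nn_integral_add) auto
  also have "(\<integral>\<^sup>+w. indicator {a<..} w * ennreal (exp (- 2 * \<gamma> * (w - a)) * ?n w) \<partial>lborel)
     = (\<integral>\<^sup>+w. indicator {a<..} (2 * a - w) * ennreal (exp (- 2 * \<gamma> * (a - w)) * ?n (2 * a - w)) \<partial>lborel)"
    by (subst nn_integral_real_affine[where c="-1" and t="2 * a"]) auto
  also have "\<dots> = (\<integral>\<^sup>+w. ennreal (?n w) * (indicator {..<a} w * ennreal (exp (- 2 * (a - w) * (a - y) / r))) \<partial>lborel)"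
    unfolding nd by (auto intro!: nn_integral_cong simp: indicator_def ennreal_mult)
  also have "(\<integral>\<^sup>+w. ennreal (?n w) * indicator {a<..} w \<partial>lborel) + \<dots>
    = (\<integral>\<^sup>+w. ennreal (?n w) *
     (indicator {a<..} w + indicator {..<a} w * ennreal (exp (- 2 * (a - w) * (a - y) / r))) \<partial>lborel)"
    by (subst nn_integral_add[symmetric]) (auto intro!: nn_integral_cong simp: distrib_left)
  finally show ?thesis .
qed

text \<open>For y above and w below the barrier, the exponent (w - a) (a - y) in the reflected form is nonnegative.
  The barrier itself is covered by neither indicator, so the comparison holds almost everywhere.\<close>
lemma payoff_mean_ge_1:
  assumes "r \<ge> 0" and y: "y > a"
  shows "1 \<le> payoff_mean \<gamma> a r y"
proof (cases "r = 0")
  case True then show ?thesis using y by (simp add: payoff_mean_def payoff_def ennreal_plus[symmetric] del: ennreal_plus)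
next
  case False
  then have r: "r > 0" using assms by simp
  have "1 = (\<integral>\<^sup>+w. ennreal (normal_density (y + \<gamma> * r) (sqrt r) w) \<partial>lborel)"
    using r by (simp add: nn_integral_normal_density)
  also have "\<dots> \<le> payoff_mean \<gamma> a r y"
    unfolding payoff_mean_reflect[OF r]
  proof (intro nn_integral_mono_AE)
    show "AE w in lborel. ennreal (normal_density (y + \<gamma> * r) (sqrt r) w) \<le>
      ennreal (normal_density (y + \<gamma> * r) (sqrt r) w) *
     (indicator {a<..} w + indicator {..<a} w * ennreal (exp (- 2 * (a - w) * (a - y) / r)))"
      using AE_lborel_singleton[of a]
    proof eventually_elim
      fix w assume "w \<noteq> a"
      moreover have "1 \<le> ennreal (exp (- 2 * (a - w) * (a - y) / r))" if "w < a"
      proof -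
        have "0 \<le> - 2 * (a - w) * (a - y) / r"
          using that y r by (intro divide_nonneg_pos mult_nonpos_nonpos) auto
        then show ?thesis unfolding one_le_exp_iff[symmetric] by (simp only: ennreal_1[symmetric] ennreal_leI)
      qed
      ultimately have "1 \<le> (indicator {a<..} w + indicator {..<a} w * ennreal (exp (- 2 * (a - w) * (a - y) / r)))"
        by (auto simp: indicator_def)
      then show "ennreal (normal_density (y + \<gamma> * r) (sqrt r) w) \<le>
      ennreal (normal_density (y + \<gamma> * r) (sqrt r) w) *
     (indicator {a<..} w + indicator {..<a} w * ennreal (exp (- 2 * (a - w) * (a - y) / r)))"
        using mult_left_mono by fastforce
    qed
  qed
  finally show ?thesis .
qed

lemma payoff_mean_le_1:
  assumes "r \<ge> 0" and y: "y \<le> a"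
  shows "payoff_mean \<gamma> a r y \<le> 1"
proof (cases "r = 0")
  case True then show ?thesis using y by (simp add: payoff_mean_def payoff_def)
next
  case False
  then have r: "r > 0" using assms by simp
  have "payoff_mean \<gamma> a r y \<le> (\<integral>\<^sup>+w. ennreal (normal_density (y + \<gamma> * r) (sqrt r) w) \<partial>lborel)"
    unfolding payoff_mean_reflect[OF r]
  proof (intro nn_integral_mono)
    fix w
    have "ennreal (exp (- 2 * (a - w) * (a - y) / r)) \<le> 1" if "w < a"
    proof -
      have "- 2 * (a - w) * (a - y) / r \<le> 0"
        using that y r by (intro divide_nonpos_pos mult_nonpos_nonneg) auto
      then show ?thesis unfolding exp_le_one_iff[symmetric] by (simp only: ennreal_1[symmetric] ennreal_leI)
    qed
    then have "(indicator {a<..} w + indicator {..<a} w * ennreal (exp (- 2 * (a - w) * (a - y) / r))) \<le> 1"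
      by (auto simp: indicator_def)
    then show "ennreal (normal_density (y + \<gamma> * r) (sqrt r) w) *
     (indicator {a<..} w + indicator {..<a} w * ennreal (exp (- 2 * (a - w) * (a - y) / r)))
     \<le> ennreal (normal_density (y + \<gamma> * r) (sqrt r) w)"
      using mult_left_mono by fastforce
  qed
  also have "\<dots> = 1" using r by (simp add: nn_integral_normal_density)
  finally show ?thesis .
qed

lemma payoff_le_2: "\<gamma> \<ge> 0 \<Longrightarrow> payoff \<gamma> a w \<le> 2"
proof (cases "a < w")
  case True
  assume "\<gamma> \<ge> 0"
  then have "1 + exp (- 2 * \<gamma> * (w - a)) \<le> 2" using True by simp
  then have "ennreal (1 + exp (- 2 * \<gamma> * (w - a))) \<le> ennreal 2" by (rule ennreal_leI)
  then show ?thesis using True by (simp add: payoff_def del: ennreal_plus)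
qed (simp add: payoff_def)

lemma payoff_mean_le_2:
  assumes "r \<ge> 0" and \<gamma>: "\<gamma> \<ge> 0"
  shows "payoff_mean \<gamma> a r y \<le> 2"
proof (cases "r = 0")
  case True then show ?thesis using payoff_le_2[OF \<gamma>] by (simp add: payoff_mean_def)
next
  case False
  then have r: "r > 0" using assms by simp
  have "payoff_mean \<gamma> a r y \<le> (\<integral>\<^sup>+w. 2 * ennreal (normal_density (y + \<gamma> * r) (sqrt r) w) \<partial>lborel)"
    using False unfolding payoff_mean_def by (auto intro!: nn_integral_mono mult_right_mono payoff_le_2[OF \<gamma>])
  also have "\<dots> = 2" using r by (simp add: nn_integral_cmult nn_integral_normal_density)
  finally show ?thesis .
qed

text \<open>From the starting point 0, the exponential weight replaces the drift \<gamma> by - \<gamma> at the price of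
  the factor exp(2 \<gamma> a); this produces the second tail.\<close>
lemma payoff_mean_0:
  assumes r: "r > 0"
  shows "payoff_mean \<gamma> a r 0 = ennreal (passage_prob \<gamma> a r)"
proof -
  have nd: "exp (- 2 * \<gamma> * (w - a)) * normal_density (\<gamma> * r) (sqrt r) w = exp (2 * \<gamma> * a) * normal_density (- \<gamma> * r) (sqrt r) w" for w
  proof -
    have "- 2 * \<gamma> * (w - a) + (- (w - \<gamma> * r)\<^sup>2 / (2 * r)) = 2 * \<gamma> * a + (- (w - (- \<gamma> * r))\<^sup>2 / (2 * r))"
      using r by (simp add: divide_simps) (simp add: power2_eq_square algebra_simps)
    then have "exp (- 2 * \<gamma> * (w - a)) * exp (- (w - \<gamma> * r)\<^sup>2 / (2 * r)) = exp (2 * \<gamma> * a) * exp (- (w - (- \<gamma> * r))\<^sup>2 / (2 * r))"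
      by (simp only: exp_add[symmetric])
    then show ?thesis using r unfolding normal_density_def by simp
  qed
  have nd': "exp (- (2 * \<gamma> * (w - a))) * normal_density (\<gamma> * r) (sqrt r) w = exp (2 * \<gamma> * a) * normal_density (- (\<gamma> * r)) (sqrt r) w" for w
    using nd[of w] by simp
  have "payoff_mean \<gamma> a r 0 = (\<integral>\<^sup>+w. indicator {a<..} w * ennreal (normal_density (\<gamma> * r) (sqrt r) w)
      + ennreal (exp (2 * \<gamma> * a)) * (indicator {a<..} w * ennreal (normal_density (- \<gamma> * r) (sqrt r) w)) \<partial>lborel)"
    using r unfolding payoff_mean_def payoff_def
    by (auto intro!: nn_integral_cong simp: indicator_def ennreal_mult[symmetric] ennreal_plus[symmetric] distrib_right nd' simp del: ennreal_plus)
  also have "\<dots> = ennreal (passage_prob \<gamma> a r)"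
    using r by (simp add: nn_integral_add nn_integral_cmult nn_integral_normal_tail passage_prob_def gauss_tail_nonneg ennreal_mult del: mult_minus_left)
  finally show ?thesis .
qed

section \<open>First passage of random walks\<close>

text \<open>The joint law of the first k variables and the next one is a product measure, so the next
  variable can be integrated out for fixed values of the earlier ones.\<close>
lemma (in prob_space) nn_integral_indep_last:
  fixes \<xi> :: "nat \<Rightarrow> 'a \<Rightarrow> real"
  assumes ind: "indep_vars (\<lambda>_. borel) \<xi> {..<n}" and k: "k < n"
    and [measurable]: "case_prod \<phi> \<in> borel_measurable (PiM {..<k} (\<lambda>_. borel) \<Otimes>\<^sub>M borel)"
  shows "(\<integral>\<^sup>+\<omega>. \<phi> (restrict (\<lambda>i. \<xi> i \<omega>) {..<k}) (\<xi> k \<omega>) \<partial>M)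
       = (\<integral>\<^sup>+\<omega>. (\<integral>\<^sup>+z. \<phi> (restrict (\<lambda>i. \<xi> i \<omega>) {..<k}) z \<partial>distr M borel (\<xi> k)) \<partial>M)"
proof -
  \<comment> \<open>The single variable is treated as a vector indexed by a singleton, because independence of two
    random variables is expressed for variables of the same type.\<close>
  let ?P = "PiM {..<k} (\<lambda>_. borel :: real measure)" and ?Q = "PiM {k} (\<lambda>_. borel :: real measure)"
  let ?Y = "\<lambda>\<omega>. restrict (\<lambda>i. \<xi> i \<omega>) {..<k}" and ?Z = "\<lambda>\<omega>. restrict (\<lambda>i. \<xi> i \<omega>) {k}"
  have iv: "indep_var ?P ?Y ?Q ?Z"
    by (rule indep_var_restrict[OF ind]) (use k in auto)
  then have [measurable]: "?Y \<in> measurable M ?P" "?Z \<in> measurable M ?Q"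
    and joint: "distr M (?P \<Otimes>\<^sub>M ?Q) (\<lambda>\<omega>. (?Y \<omega>, ?Z \<omega>)) = distr M ?P ?Y \<Otimes>\<^sub>M distr M ?Q ?Z"
    unfolding indep_var_distribution_eq by auto
  have [measurable]: "\<xi> k \<in> borel_measurable M"
    using ind k unfolding indep_vars_def by auto
  interpret Z: prob_space "distr M ?Q ?Z" by (rule prob_space_distr) simp
  interpret Z': prob_space "distr M borel (\<xi> k)" by (rule prob_space_distr) simp
  have [measurable]: "(\<lambda>v. v k) \<in> borel_measurable ?Q"
    by (rule measurable_component_singleton) simp
  have m2[measurable]: "(\<lambda>p. \<phi> (fst p) (snd p k)) \<in> borel_measurable (?P \<Otimes>\<^sub>M ?Q)"
    by (rule measurable_compose[OF _ assms(3), of "\<lambda>p. (fst p, snd p k)", simplified]) measurable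
  have inner: "(\<integral>\<^sup>+v. \<phi> y (v k) \<partial>distr M ?Q ?Z) = (\<integral>\<^sup>+z. \<phi> y z \<partial>distr M borel (\<xi> k))"
    if "y \<in> space ?P" for y
  proof -
    have [measurable]: "\<phi> y \<in> borel_measurable borel"
      using measurable_compose[OF measurable_Pair1'[OF that] assms(3)] by simp
    show ?thesis by (simp add: nn_integral_distr)
  qed
  have "(\<integral>\<^sup>+\<omega>. \<phi> (?Y \<omega>) (\<xi> k \<omega>) \<partial>M)
      = (\<integral>\<^sup>+p. \<phi> (fst p) (snd p k) \<partial>distr M (?P \<Otimes>\<^sub>M ?Q) (\<lambda>\<omega>. (?Y \<omega>, ?Z \<omega>)))"
    by (subst nn_integral_distr) auto
  also have "\<dots> = (\<integral>\<^sup>+y. (\<integral>\<^sup>+v. \<phi> y (v k) \<partial>distr M ?Q ?Z) \<partial>distr M ?P ?Y)"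
    unfolding joint using m2
    by (subst Z.nn_integral_fst[symmetric]) (auto cong: measurable_cong_sets sets_pair_measure_cong)
  also have "\<dots> = (\<integral>\<^sup>+y. (\<integral>\<^sup>+z. \<phi> y z \<partial>distr M borel (\<xi> k)) \<partial>distr M ?P ?Y)"
    by (intro nn_integral_cong) (auto simp: inner)
  also have "\<dots> = (\<integral>\<^sup>+\<omega>. (\<integral>\<^sup>+z. \<phi> (?Y \<omega>) z \<partial>distr M borel (\<xi> k)) \<partial>M)"
    by (subst nn_integral_distr) (auto intro!: Z'.borel_measurable_nn_integral)
  finally show ?thesis .
qed

locale random_walk = prob_space +
  fixes \<xi> :: "nat \<Rightarrow> 'a \<Rightarrow> real" and n :: nat and N :: "real measure"
  assumes indep: "indep_vars (\<lambda>_. borel) \<xi> {..<n}"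
    and law: "\<And>i. i < n \<Longrightarrow> distr M borel (\<xi> i) = N"
begin

definition walk :: "nat \<Rightarrow> 'a \<Rightarrow> real" where "walk k \<omega> = (\<Sum>i<k. \<xi> i \<omega>)"

definition stay_below :: "real \<Rightarrow> nat \<Rightarrow> 'a set" where
  "stay_below a k = {\<omega>\<in>space M. \<forall>j\<le>k. walk j \<omega> \<le> a}"

lemma step_measurable: "i < n \<Longrightarrow> \<xi> i \<in> borel_measurable M"
  using indep unfolding indep_vars_def by auto

lemma walk_measurable: "k \<le> n \<Longrightarrow> walk k \<in> borel_measurable M"
  unfolding walk_def by (intro borel_measurable_sum step_measurable) auto

lemma stay_below_sets: "k \<le> n \<Longrightarrow> stay_below a k \<in> sets M"
proof -
  assume k: "k \<le> n"
  have "stay_below a k = space M \<inter> (\<Inter>j\<in>{..k}. {\<omega>\<in>space M. walk j \<omega> \<le> a})"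
    unfolding stay_below_def by auto
  also have "\<dots> \<in> sets M"
    using k by (intro sets.Int sets.finite_INT sets.top borel_measurable_le walk_measurable) auto
  finally show ?thesis .
qed

lemma one_step:
  assumes k: "k < n" and V [measurable]: "V \<in> borel_measurable borel"
  shows "(\<integral>\<^sup>+\<omega>. indicator (stay_below a k) \<omega> * V (walk (Suc k) \<omega>) \<partial>M)
       = (\<integral>\<^sup>+\<omega>. indicator (stay_below a k) \<omega> * (\<integral>\<^sup>+z. V (walk k \<omega> + z) \<partial>N) \<partial>M)"
proof -
  define \<phi> where "\<phi> v z = indicator {v. \<forall>j\<in>{..k}. (\<Sum>i<j. v i) \<le> a} v * V ((\<Sum>i<k. v i) + z)"
    for v :: "nat \<Rightarrow> real" and z
  have [measurable]: "(\<lambda>p. \<Sum>i<j. fst p i :: real) \<in> borel_measurable (PiM {..<k} (\<lambda>_. borel) \<Otimes>\<^sub>M (borel :: real measure))"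
    if "j \<le> k" for j
  proof (rule borel_measurable_sum)
    fix i assume "i \<in> {..<j}"
    then show "(\<lambda>p. fst p i) \<in> borel_measurable (PiM {..<k} (\<lambda>_. borel) \<Otimes>\<^sub>M (borel :: real measure))"
      using that by (intro measurable_compose[OF measurable_fst] measurable_component_singleton) auto
  qed
  have "case_prod \<phi> \<in> borel_measurable (PiM {..<k} (\<lambda>_. borel) \<Otimes>\<^sub>M borel)"
  proof -
    have "{p \<in> space (PiM {..<k} (\<lambda>_. borel) \<Otimes>\<^sub>M (borel::real measure)). \<forall>j\<in>{..k}. (\<Sum>i<j. fst p i) \<le> a}
       \<in> sets (PiM {..<k} (\<lambda>_. borel :: real measure) \<Otimes>\<^sub>M borel)"
      by (intro sets.sets_Collect_finite_All borel_measurable_le) auto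
    then have "(\<lambda>p. indicator {v. \<forall>j\<in>{..k}. (\<Sum>i<j. v i) \<le> a} (fst p) :: ennreal) 
       \<in> borel_measurable (PiM {..<k} (\<lambda>_. borel) \<Otimes>\<^sub>M (borel::real measure))"
      unfolding indicator_def of_bool_def mem_Collect_eq by (intro measurable_If) auto
    then show ?thesis unfolding \<phi>_def case_prod_beta by measurable
  qed
  note eq = nn_integral_indep_last[OF indep k this]
  have r: "(\<Sum>i<j. restrict (\<lambda>i. \<xi> i \<omega>) {..<k} i) = walk j \<omega>" if "j \<le> k" for j \<omega>
    unfolding walk_def using that by (intro sum.cong) auto
  have 1: "\<phi> (restrict (\<lambda>i. \<xi> i \<omega>) {..<k}) z = indicator (stay_below a k) \<omega> * V (walk k \<omega> + z)"
    if "\<omega> \<in> space M" for \<omega> z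
    unfolding \<phi>_def r[OF order_refl] using that by (auto simp: indicator_def stay_below_def walk_def)
  have "(\<integral>\<^sup>+\<omega>. indicator (stay_below a k) \<omega> * V (walk (Suc k) \<omega>) \<partial>M)
      = (\<integral>\<^sup>+\<omega>. \<phi> (restrict (\<lambda>i. \<xi> i \<omega>) {..<k}) (\<xi> k \<omega>) \<partial>M)"
    by (intro nn_integral_cong) (simp add: 1, simp add: walk_def)
  also note eq
  also have "(\<integral>\<^sup>+\<omega>. (\<integral>\<^sup>+z. \<phi> (restrict (\<lambda>i. \<xi> i \<omega>) {..<k}) z \<partial>distr M borel (\<xi> k)) \<partial>M)
     = (\<integral>\<^sup>+\<omega>. indicator (stay_below a k) \<omega> * (\<integral>\<^sup>+z. V (walk k \<omega> + z) \<partial>N) \<partial>M)"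
    using k law[OF k, symmetric] by (intro nn_integral_cong) (simp add: 1 nn_integral_cmult)
  finally show ?thesis .
qed

text \<open>The mean after k steps of a game that pays 1 once the walk has exceeded the level a and is worth V
  of the remaining time and the current position until then. For a martingale V it decreases in k if
  V \<ge> 1 where the walk lands above a, and increases if V \<le> 1 there.\<close>
definition stopped_value :: "real \<Rightarrow> (nat \<Rightarrow> real \<Rightarrow> ennreal) \<Rightarrow> nat \<Rightarrow> ennreal" where
  "stopped_value a V k = (\<integral>\<^sup>+\<omega>. indicator (stay_below a k) \<omega> * V (n - k) (walk k \<omega>) \<partial>M)
      + emeasure M (space M - stay_below a k)"

context
  fixes V :: "nat \<Rightarrow> real \<Rightarrow> ennreal" and a :: real
  assumes V_meas: "\<And>j. V j \<in> borel_measurable borel"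
    and V_step: "\<And>j y. V (Suc j) y = (\<integral>\<^sup>+z. V j (y + z) \<partial>N)"
    and a_nonneg: "0 \<le> a"
begin

lemma stopped_value_0: "stopped_value a V 0 = V n 0"
proof -
  have "stay_below a 0 = space M" using a_nonneg by (auto simp: stay_below_def walk_def)
  then show ?thesis
    by (simp add: stopped_value_def walk_def nn_integral_cmult_indicator mult.commute[of "indicator _ _"] emeasure_space_1)
qed

definition overshoot_set where "overshoot_set k = stay_below a k - stay_below a (Suc k)"

lemma
  shows overshoot_eq: "overshoot_set k = {\<omega>\<in>stay_below a k. walk (Suc k) \<omega> > a}"
  and stay_below_Suc_subset: "stay_below a (Suc k) \<subseteq> stay_below a k"
  by (auto simp: overshoot_set_def stay_below_def le_Suc_eq not_le)

text \<open>Consecutive values differ only on the event that the walk passes the level at step k + 1: there the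
  first one has V evaluated at the walk, the second one has 1.\<close>
lemma stopped_value_split:
  assumes k: "k < n"
  shows "stopped_value a V k = 
    (\<integral>\<^sup>+\<omega>. indicator (stay_below a (Suc k)) \<omega> * V (n - Suc k) (walk (Suc k) \<omega>) \<partial>M)
    + (\<integral>\<^sup>+\<omega>. indicator (overshoot_set k) \<omega> * V (n - Suc k) (walk (Suc k) \<omega>) \<partial>M)
    + emeasure M (space M - stay_below a k)"
    and "stopped_value a V (Suc k) =
    (\<integral>\<^sup>+\<omega>. indicator (stay_below a (Suc k)) \<omega> * V (n - Suc k) (walk (Suc k) \<omega>) \<partial>M)
    + emeasure M (overshoot_set k) + emeasure M (space M - stay_below a k)"
proof -
  have [measurable]: "stay_below a k \<in> sets M" "stay_below a (Suc k) \<in> sets M" "walk (Suc k) \<in> borel_measurable M"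
    "overshoot_set k \<in> sets M" "V (n - Suc k) \<in> borel_measurable borel"
    using k stay_below_sets walk_measurable V_meas by (auto simp: overshoot_set_def)
  have "(\<integral>\<^sup>+\<omega>. indicator (stay_below a k) \<omega> * V (n - k) (walk k \<omega>) \<partial>M)
     = (\<integral>\<^sup>+\<omega>. indicator (stay_below a k) \<omega> * V (n - Suc k) (walk (Suc k) \<omega>) \<partial>M)"
    unfolding one_step[OF k V_meas] using V_step[of "n - Suc k"] k by (simp add: Suc_diff_Suc)
  also have "\<dots> = (\<integral>\<^sup>+\<omega>. indicator (stay_below a (Suc k)) \<omega> * V (n - Suc k) (walk (Suc k) \<omega>)
      + indicator (overshoot_set k) \<omega> * V (n - Suc k) (walk (Suc k) \<omega>) \<partial>M)"
    using stay_below_Suc_subset[of k]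
    by (intro nn_integral_cong) (auto simp: overshoot_set_def indicator_def)
  finally show "stopped_value a V k = 
    (\<integral>\<^sup>+\<omega>. indicator (stay_below a (Suc k)) \<omega> * V (n - Suc k) (walk (Suc k) \<omega>) \<partial>M)
    + (\<integral>\<^sup>+\<omega>. indicator (overshoot_set k) \<omega> * V (n - Suc k) (walk (Suc k) \<omega>) \<partial>M)
    + emeasure M (space M - stay_below a k)"
    unfolding stopped_value_def by (simp add: nn_integral_add)
  have "space M - stay_below a (Suc k) = overshoot_set k \<union> (space M - stay_below a k)"
    using stay_below_Suc_subset[of k] sets.sets_into_space[of "stay_below a k" M]
    by (auto simp: overshoot_set_def)
  moreover have "overshoot_set k \<inter> (space M - stay_below a k) = {}" by (auto simp: overshoot_set_def)
  ultimately have "emeasure M (space M - stay_below a (Suc k))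
     = emeasure M (overshoot_set k) + emeasure M (space M - stay_below a k)"
    by (simp add: plus_emeasure)
  then show "stopped_value a V (Suc k) =
    (\<integral>\<^sup>+\<omega>. indicator (stay_below a (Suc k)) \<omega> * V (n - Suc k) (walk (Suc k) \<omega>) \<partial>M)
    + emeasure M (overshoot_set k) + emeasure M (space M - stay_below a k)"
    unfolding stopped_value_def by (simp add: add.assoc)
qed

text \<open>Optional stopping for a martingale that dominates 1 above the level.\<close>
lemma crossing_prob_le:
  assumes ge1: "\<And>j y. y > a \<Longrightarrow> 1 \<le> V j y"
  shows "emeasure M (space M - stay_below a n) \<le> V n 0"
proof -
  have "stopped_value a V k \<le> V n 0" if "k \<le> n" for k
    using that
  proof (induction k)
    case 0 then show ?case by (simp add: stopped_value_0)
  next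
    case (Suc k)
    then have k: "k < n" by simp
    have [measurable]: "overshoot_set k \<in> sets M"
      using k stay_below_sets by (auto simp: overshoot_set_def)
    have "emeasure M (overshoot_set k) = (\<integral>\<^sup>+\<omega>. indicator (overshoot_set k) \<omega> \<partial>M)" by simp
    also have "\<dots> \<le> (\<integral>\<^sup>+\<omega>. indicator (overshoot_set k) \<omega> * V (n - Suc k) (walk (Suc k) \<omega>) \<partial>M)"
      using ge1 by (intro nn_integral_mono) (auto simp: indicator_def overshoot_eq)
    finally have "stopped_value a V (Suc k) \<le> stopped_value a V k"
      unfolding stopped_value_split[OF k] by (intro add_mono) auto
    then show ?case using Suc by simp
  qed
  from this[of n] have "stopped_value a V n \<le> V n 0" by simp
  then show ?thesis unfolding stopped_value_def by (metis add_increasing order_trans zero_le le_iff_add add.commute)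
qed

text \<open>The first position above a still lies below a + \<epsilon>, where V \<le> 1, unless the step leading there
  exceeds \<epsilon>; on that event the bound 2 is used instead. At the end V vanishes below a, so only
  walks that have crossed contribute.\<close>
lemma crossing_prob_ge:
  assumes \<epsilon>: "0 < \<epsilon>" and le1: "\<And>j y. y \<le> a + \<epsilon> \<Longrightarrow> V j y \<le> 1" and le2: "\<And>j y. V j y \<le> 2"
    and V0: "\<And>y. y \<le> a \<Longrightarrow> V 0 y = 0"
  shows "V n 0 \<le> emeasure M (space M - stay_below a n) + of_nat n * (2 * emeasure N {\<epsilon><..})"
proof -
  have "V n 0 \<le> stopped_value a V k + of_nat k * (2 * emeasure N {\<epsilon><..})" if "k \<le> n" for k
    using that
  proof (induction k)
    case 0 then show ?case by (simp add: stopped_value_0)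
  next
    case (Suc k)
    then have k: "k < n" by simp
    have [measurable]: "overshoot_set k \<in> sets M" "\<xi> k \<in> borel_measurable M"
      using k stay_below_sets step_measurable by (auto simp: overshoot_set_def)
    have "(\<integral>\<^sup>+\<omega>. indicator (overshoot_set k) \<omega> * V (n - Suc k) (walk (Suc k) \<omega>) \<partial>M)
       \<le> (\<integral>\<^sup>+\<omega>. indicator (overshoot_set k) \<omega> + 2 * indicator (\<xi> k -` {\<epsilon><..} \<inter> space M) \<omega> \<partial>M)"
    proof (intro nn_integral_mono)
      fix \<omega> assume \<omega>: "\<omega> \<in> space M"
      show "indicator (overshoot_set k) \<omega> * V (n - Suc k) (walk (Suc k) \<omega>)
        \<le> indicator (overshoot_set k) \<omega> + 2 * indicator (\<xi> k -` {\<epsilon><..} \<inter> space M) \<omega>"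
      proof (cases "\<xi> k \<omega> > \<epsilon>")
        case True
        \<comment> \<open>Here both indicators on the right may be 1, and V is at most 2.\<close>
        have "V (n - Suc k) (walk (Suc k) \<omega>) \<le> 1 + 2"
          by (rule order_trans[OF le2]) simp
        then show ?thesis using True \<omega> le2 by (auto simp: indicator_def)
      next
        case False
        show ?thesis
        proof (cases "\<omega> \<in> overshoot_set k")
          case True
          then have "walk k \<omega> \<le> a" by (auto simp: overshoot_eq stay_below_def)
          then have "walk (Suc k) \<omega> \<le> a + \<epsilon>" using False by (auto simp: walk_def)
          then show ?thesis using True False le1 by (simp add: indicator_def)
        qed simp
      qed
    qed
    also have "\<dots> = emeasure M (overshoot_set k) + 2 * emeasure N {\<epsilon><..}"
      by (simp add: nn_integral_add nn_integral_cmult law[OF k, symmetric] emeasure_distr)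
    finally have "stopped_value a V k \<le> stopped_value a V (Suc k) + 2 * emeasure N {\<epsilon><..}"
      unfolding stopped_value_split[OF k]
      by (smt (verit, ccfv_SIG) add.assoc add.commute add_left_mono)
    then show ?case using Suc.IH k 
      by (simp add: distrib_right) (smt (verit, ccfv_SIG) add.assoc add.commute add_left_mono order_trans)
  qed
  from this[of n] have "V n 0 \<le> stopped_value a V n + of_nat n * (2 * emeasure N {\<epsilon><..})" by simp
  also have "(\<integral>\<^sup>+\<omega>. indicator (stay_below a n) \<omega> * V (n - n) (walk n \<omega>) \<partial>M) = (\<integral>\<^sup>+\<omega>. 0 \<partial>M)"
    using V0 by (intro nn_integral_cong) (auto simp: indicator_def stay_below_def)
  then have "stopped_value a V n = emeasure M (space M - stay_below a n)"
    unfolding stopped_value_def by simp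
  finally show ?thesis .
qed

end
end

section \<open>Running maximum of Brownian motion with drift\<close>

context standard_brownian_motion
begin

text \<open>Subtracting B 0 makes the path start at 0 everywhere, not only almost everywhere.\<close>
definition drifted :: "real \<Rightarrow> real \<Rightarrow> 'a \<Rightarrow> real" where
  "drifted \<gamma> s \<omega> = B s \<omega> - B 0 \<omega> + \<gamma> * s"

definition grid_passage :: "real \<Rightarrow> real \<Rightarrow> real \<Rightarrow> nat \<Rightarrow> 'a set" where
  "grid_passage \<gamma> a t n = {\<omega>\<in>space M. \<exists>k\<le>n. a < drifted \<gamma> (t * real k / real n) \<omega>}"

definition passage :: "real \<Rightarrow> real \<Rightarrow> real \<Rightarrow> 'a set" where
  "passage \<gamma> a t = {\<omega>\<in>space M. \<exists>s\<in>{0..t}. a < drifted \<gamma> s \<omega>}"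

text \<open>Sampled at n equidistant times, the motion with drift is a walk with independent normal steps.\<close>
lemma random_walk_grid:
  assumes t: "t > 0" and n: "n > 0"
  shows "random_walk M (\<lambda>i \<omega>. drifted \<gamma> (t * real (Suc i) / real n) \<omega> - drifted \<gamma> (t * real i / real n) \<omega>) n
     (density lborel (\<lambda>z. ennreal (normal_density (\<gamma> * (t / real n)) (sqrt (t / real n)) z)))"
proof -
  define \<tau> where "\<tau> i = t * real i / real n" for i
  have \<tau>_less: "\<tau> i < \<tau> (Suc i)" for i using t n by (simp add: \<tau>_def field_simps)
  have \<tau>_diff: "\<tau> (Suc i) - \<tau> i = t / real n" for i using t n by (simp add: \<tau>_def field_simps)
  have inc: "drifted \<gamma> (\<tau> (Suc i)) \<omega> - drifted \<gamma> (\<tau> i) \<omega> = (B (\<tau> (Suc i)) \<omega> - B (\<tau> i) \<omega>) + \<gamma> * (t / real n)" for i \<omega>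
    unfolding drifted_def \<tau>_diff[of i, symmetric] by (simp add: algebra_simps)
  have "indep_vars (\<lambda>_. borel) (\<lambda>i \<omega>. B (\<tau> (Suc i)) \<omega> - B (\<tau> i) \<omega>) {..<n}"
    using t \<tau>_less by (intro BM_indep_increments) (auto simp: \<tau>_def)
  then have ind: "indep_vars (\<lambda>_. borel) (\<lambda>i \<omega>. drifted \<gamma> (\<tau> (Suc i)) \<omega> - drifted \<gamma> (\<tau> i) \<omega>) {..<n}"
    unfolding inc by (rule indep_vars_compose2) simp
  have law: "distr M borel (\<lambda>\<omega>. drifted \<gamma> (\<tau> (Suc i)) \<omega> - drifted \<gamma> (\<tau> i) \<omega>)
     = density lborel (\<lambda>z. ennreal (normal_density (\<gamma> * (t / real n)) (sqrt (t / real n)) z))" for i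
  proof -
    have "distributed M lborel (\<lambda>\<omega>. B (\<tau> (Suc i)) \<omega> - B (\<tau> i) \<omega>) (\<lambda>x. ennreal (normal_density 0 (sqrt (t / real n)) x))"
      using BM_normal_increments[of "\<tau> i" "\<tau> (Suc i)"] \<tau>_less[of i] \<tau>_diff[of i] t by (simp add: \<tau>_def)
    from normal_density_affine[OF this, of 1 "\<gamma> * (t / real n)"]
    have "distributed M lborel (\<lambda>\<omega>. drifted \<gamma> (\<tau> (Suc i)) \<omega> - drifted \<gamma> (\<tau> i) \<omega>) (\<lambda>x. ennreal (normal_density (\<gamma> * (t / real n)) (sqrt (t / real n)) x))"
      using t n unfolding inc by (simp add: add.commute)
    then have "distr M lborel (\<lambda>\<omega>. drifted \<gamma> (\<tau> (Suc i)) \<omega> - drifted \<gamma> (\<tau> i) \<omega>) = density lborel (\<lambda>x. ennreal (normal_density (\<gamma> * (t / real n)) (sqrt (t / real n)) x))"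
      by (rule distributed_distr_eq_density)
    moreover have "distr M borel (\<lambda>\<omega>. drifted \<gamma> (\<tau> (Suc i)) \<omega> - drifted \<gamma> (\<tau> i) \<omega>)
      = distr M lborel (\<lambda>\<omega>. drifted \<gamma> (\<tau> (Suc i)) \<omega> - drifted \<gamma> (\<tau> i) \<omega>)"
      by (rule distr_cong) auto
    ultimately show ?thesis by simp
  qed
  show ?thesis
    using ind law unfolding \<tau>_def
    by (intro random_walk.intro prob_space_axioms random_walk_axioms.intro) auto
qed

lemma
  assumes t: "t > 0" and n: "n > 0" and \<gamma>: "\<gamma> \<ge> 0" and a: "a \<ge> 0"
  shows grid_passage_sets: "grid_passage \<gamma> a t n \<in> events"
    and grid_passage_le: "emeasure M (grid_passage \<gamma> a t n) \<le> ennreal (passage_prob \<gamma> a t)"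
    and grid_passage_ge: "0 < \<epsilon> \<Longrightarrow> ennreal (passage_prob \<gamma> (a + \<epsilon>) t) \<le> emeasure M (grid_passage \<gamma> a t n)
      + of_nat n * (2 * emeasure (density lborel (\<lambda>z. ennreal (normal_density (\<gamma> * (t / real n)) (sqrt (t / real n)) z))) {\<epsilon><..})"
proof -
  interpret W: random_walk M "\<lambda>i \<omega>. drifted \<gamma> (t * real (Suc i) / real n) \<omega> - drifted \<gamma> (t * real i / real n) \<omega>" n
     "density lborel (\<lambda>z. ennreal (normal_density (\<gamma> * (t / real n)) (sqrt (t / real n)) z))"
    by (rule random_walk_grid[OF t n])
  have walk: "W.walk k \<omega> = drifted \<gamma> (t * real k / real n) \<omega>" for k \<omega>
    unfolding W.walk_def
    by (subst sum_lessThan_telescope[where f="\<lambda>i. drifted \<gamma> (t * real i / real n) \<omega>"]) (simp add: drifted_def)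
  have eq: "space M - W.stay_below a n = grid_passage \<gamma> a t n"
    unfolding W.stay_below_def grid_passage_def walk by (auto simp: not_le)
  show "grid_passage \<gamma> a t n \<in> events"
    unfolding eq[symmetric] using W.stay_below_sets[of n a] by auto
  have step: "payoff_mean \<gamma> b (real (Suc j) * (t / real n)) y = (\<integral>\<^sup>+z. payoff_mean \<gamma> b (real j * (t / real n)) (y + z)
     \<partial>density lborel (\<lambda>z. ennreal (normal_density (\<gamma> * (t / real n)) (sqrt (t / real n)) z)))" for b j y
    using payoff_mean_add[of "real j * (t / real n)" "t / real n" \<gamma> b y] t n by (simp add: field_simps)
  have initial: "payoff_mean \<gamma> b (real n * (t / real n)) 0 = ennreal (passage_prob \<gamma> b t)" for b
    using t n by (simp add: payoff_mean_0)
  have nn: "0 \<le> real j * (t / real n)" for j using t by simp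
  show "emeasure M (grid_passage \<gamma> a t n) \<le> ennreal (passage_prob \<gamma> a t)"
    unfolding eq[symmetric] initial[symmetric]
  proof (rule W.crossing_prob_le[where V="\<lambda>j. payoff_mean \<gamma> a (real j * (t / real n))"])
    show "1 \<le> payoff_mean \<gamma> a (real j * (t / real n)) y" if "a < y" for j y
      using nn that by (rule payoff_mean_ge_1)
  qed (fact payoff_mean_measurable step a)+
  show "ennreal (passage_prob \<gamma> (a + \<epsilon>) t) \<le> emeasure M (grid_passage \<gamma> a t n)
      + of_nat n * (2 * emeasure (density lborel (\<lambda>z. ennreal (normal_density (\<gamma> * (t / real n)) (sqrt (t / real n)) z))) {\<epsilon><..})"
    if "0 < \<epsilon>"
    unfolding eq[symmetric] initial[symmetric]
  proof (rule W.crossing_prob_ge[where V="\<lambda>j. payoff_mean \<gamma> (a + \<epsilon>) (real j * (t / real n))"])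
    show "payoff_mean \<gamma> (a + \<epsilon>) (real j * (t / real n)) y \<le> 1" if "y \<le> a + \<epsilon>" for j y
      using nn that by (rule payoff_mean_le_1)
    show "payoff_mean \<gamma> (a + \<epsilon>) (real j * (t / real n)) y \<le> 2" for j y
      using nn \<gamma> by (rule payoff_mean_le_2)
    show "payoff_mean \<gamma> (a + \<epsilon>) (real 0 * (t / real n)) y = 0" if "y \<le> a" for y
      using that \<open>0 < \<epsilon>\<close> by (simp add: payoff_mean_def payoff_def)
  qed (fact payoff_mean_measurable step a that)+
qed

lemma grid_passage_subset: "t \<ge> 0 \<Longrightarrow> grid_passage \<gamma> a t n \<subseteq> passage \<gamma> a t"
proof
  fix \<omega> assume t: "t \<ge> 0" and "\<omega> \<in> grid_passage \<gamma> a t n"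
  then obtain k where k: "\<omega> \<in> space M" "k \<le> n" "a < drifted \<gamma> (t * real k / real n) \<omega>"
    by (auto simp: grid_passage_def)
  have "t * real k / real n \<in> {0..t}"
    using t k by (auto simp: divide_le_eq intro!: mult_left_mono)
  then show "\<omega> \<in> passage \<gamma> a t" using k by (auto simp: passage_def)
qed

text \<open>The grids are dyadic because each one has to refine the previous one.\<close>
lemma incseq_grid_passage: "incseq (\<lambda>j. grid_passage \<gamma> a t (2 ^ j))"
proof (rule incseq_SucI, rule subsetI)
  fix j \<omega> assume "\<omega> \<in> grid_passage \<gamma> a t (2 ^ j)"
  then obtain k where k: "\<omega> \<in> space M" "k \<le> 2 ^ j" "a < drifted \<gamma> (t * real k / real (2 ^ j)) \<omega>"
    by (auto simp: grid_passage_def)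
  moreover have "t * real k / real (2 ^ j) = t * real (2 * k) / real (2 ^ Suc j)" by simp
  ultimately show "\<omega> \<in> grid_passage \<gamma> a t (2 ^ Suc j)"
    unfolding grid_passage_def by (intro CollectI conjI exI[of _ "2 * k"]) auto
qed

text \<open>By continuity a path above a at time s is above a in a neighbourhood of s, which contains points of
  all fine grids.\<close>
lemma passage_eq_UN:
  assumes t: "t > 0"
  shows "passage \<gamma> a t = (\<Union>j. grid_passage \<gamma> a t (2 ^ j))"
proof (intro equalityI subsetI)
  fix \<omega> assume "\<omega> \<in> passage \<gamma> a t"
  then obtain s where s: "\<omega> \<in> space M" "0 \<le> s" "s \<le> t" "a < drifted \<gamma> s \<omega>" by (auto simp: passage_def)
  have "continuous_on {0..} (\<lambda>s. drifted \<gamma> s \<omega>)"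
    unfolding drifted_def by (intro continuous_intros BM_continuous s)
  then have "((\<lambda>s. drifted \<gamma> s \<omega>) \<longlongrightarrow> drifted \<gamma> s \<omega>) (at s within {0..})"
    using s by (auto simp: continuous_on_def)
  from order_tendstoD(1)[OF this s(4)] obtain e where e: "e > 0"
    "\<And>r. r \<ge> 0 \<Longrightarrow> r \<noteq> s \<Longrightarrow> dist r s < e \<Longrightarrow> a < drifted \<gamma> r \<omega>"
    by (auto simp: eventually_at)
  obtain j where j: "t / e < 2 ^ j" using real_arch_pow[of 2 "t / e"] by auto
  \<comment> \<open>The last grid point before s; it lies within one mesh width t / 2^j < e of s.\<close>
  define k where "k = nat \<lfloor>s * 2 ^ j / t\<rfloor>"
  have nn: "0 \<le> s * 2 ^ j / t" using s t by simp
  then have k: "real k \<le> s * 2 ^ j / t" "s * 2 ^ j / t < real k + 1"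
    unfolding k_def by (auto simp: floor_le_iff)
  define r where "r = t * real k / real (2 ^ j)"
  have r: "r \<ge> 0" "r \<le> s" "s < r + t / 2 ^ j"
    using k t by (auto simp: r_def field_simps)
  have "t / 2 ^ j < e" using j e by (simp add: field_simps)
  then have "a < drifted \<gamma> r \<omega>" using e(2)[of r] r s(4) by (cases "r = s") (auto simp: dist_real_def)
  moreover have "k \<le> 2 ^ j"
  proof -
    have "s * 2 ^ j / t \<le> 2 ^ j" using s t by (simp add: field_simps)
    then have "real k \<le> 2 ^ j" using k(1) by linarith
    then show ?thesis by simp
  qed
  ultimately have "\<omega> \<in> grid_passage \<gamma> a t (2 ^ j)"
    using s by (auto simp: grid_passage_def r_def)
  then show "\<omega> \<in> (\<Union>j. grid_passage \<gamma> a t (2 ^ j))" by blast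
next
  fix \<omega> assume "\<omega> \<in> (\<Union>j. grid_passage \<gamma> a t (2 ^ j))"
  then show "\<omega> \<in> passage \<gamma> a t" using grid_passage_subset[of t] t by fastforce
qed

lemma passage_0: "a \<ge> 0 \<Longrightarrow> passage \<gamma> a 0 = {}"
  by (auto simp: passage_def drifted_def)

lemma passage_sets:
  assumes "t > 0" "\<gamma> \<ge> 0" "a \<ge> 0"
  shows "passage \<gamma> a t \<in> events"
  unfolding passage_eq_UN[OF assms(1)] using assms by (intro sets.countable_UN) (auto intro!: grid_passage_sets)

text \<open>The Bachelier-Levy formula. The upper bound holds on every grid, hence for the increasing union; the
  lower bound holds on every grid for the barrier a + \<epsilon> up to an error that vanishes with
  the mesh.\<close>
theorem emeasure_passage:
  assumes t: "t > 0" and \<gamma>: "\<gamma> \<ge> 0" and a: "a \<ge> 0"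
  shows "emeasure M (passage \<gamma> a t) = ennreal (passage_prob \<gamma> a t)"
proof (rule antisym)
  have "(SUP j. emeasure M (grid_passage \<gamma> a t (2 ^ j))) = emeasure M (\<Union>j. grid_passage \<gamma> a t (2 ^ j))"
    using assms by (intro SUP_emeasure_incseq incseq_grid_passage) (auto intro!: grid_passage_sets)
  moreover have "(SUP j. emeasure M (grid_passage \<gamma> a t (2 ^ j))) \<le> ennreal (passage_prob \<gamma> a t)"
    using assms by (intro SUP_least grid_passage_le) auto
  ultimately show "emeasure M (passage \<gamma> a t) \<le> ennreal (passage_prob \<gamma> a t)"
    unfolding passage_eq_UN[OF t] by simp
next
  have shifted: "ennreal (passage_prob \<gamma> (a + \<epsilon>) t) \<le> emeasure M (passage \<gamma> a t)" if \<epsilon>: "\<epsilon> > 0" for \<epsilon>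
  proof (rule tendsto_lowerbound)
    show "(\<lambda>n. emeasure M (passage \<gamma> a t) + of_nat n * (2 * emeasure (density lborel (\<lambda>z. ennreal (normal_density (\<gamma> * (t / real n)) (sqrt (t / real n)) z))) {\<epsilon><..}))
       \<longlonglongrightarrow> emeasure M (passage \<gamma> a t)"
      using tendsto_add[OF tendsto_const max_increment_negligible[OF t \<epsilon>, of \<gamma>], of "emeasure M (passage \<gamma> a t)"] by simp
    show "\<forall>\<^sub>F n in sequentially. ennreal (passage_prob \<gamma> (a + \<epsilon>) t) \<le> emeasure M (passage \<gamma> a t) + 
      of_nat n * (2 * emeasure (density lborel (\<lambda>z. ennreal (normal_density (\<gamma> * (t / real n)) (sqrt (t / real n)) z))) {\<epsilon><..})"
      using eventually_gt_at_top[of 0]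
    proof eventually_elim
      fix n :: nat assume n: "0 < n"
      have "emeasure M (grid_passage \<gamma> a t n) \<le> emeasure M (passage \<gamma> a t)"
        using assms by (intro emeasure_mono grid_passage_subset passage_sets) auto
      then show "ennreal (passage_prob \<gamma> (a + \<epsilon>) t) \<le> emeasure M (passage \<gamma> a t) + 
      of_nat n * (2 * emeasure (density lborel (\<lambda>z. ennreal (normal_density (\<gamma> * (t / real n)) (sqrt (t / real n)) z))) {\<epsilon><..})"
        using grid_passage_ge[OF t n \<gamma> a \<epsilon>] by (meson add_right_mono order_trans)
    qed
  qed simp
  have "((\<lambda>\<epsilon>. passage_prob \<gamma> (a + \<epsilon>) t) \<longlongrightarrow> passage_prob \<gamma> (a + 0) t) (at_right 0)"
    by (intro isCont_tendsto_compose[OF isCont_passage_prob[OF t]] tendsto_intros)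
  then have "((\<lambda>\<epsilon>. ennreal (passage_prob \<gamma> (a + \<epsilon>) t)) \<longlongrightarrow> ennreal (passage_prob \<gamma> a t)) (at_right 0)"
    by (intro tendsto_ennrealI) simp
  then show "ennreal (passage_prob \<gamma> a t) \<le> emeasure M (passage \<gamma> a t)"
    by (rule tendsto_upperbound) (auto simp: eventually_at_filter shifted)
qed

text \<open>The infima in the definitions of G and H are meaningful only if the path exceeds every level. A
  nonnegative drift only helps, so the driftless motion suffices.\<close>
lemma AE_drifted_unbounded:
  assumes \<gamma>: "\<gamma> \<ge> 0"
  shows "AE \<omega> in M. \<forall>c. \<exists>s\<ge>0. c < drifted \<gamma> s \<omega>"
proof -
  have "AE \<omega> in M. \<forall>m::nat. \<exists>s\<ge>0. real m < drifted 0 s \<omega>"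
    unfolding AE_all_countable
  proof
    fix m :: nat
    define E where "E = (\<Union>n. passage 0 (real m) (real (Suc n)))"
    have E: "E \<in> events" unfolding E_def by (intro sets.countable_UN) (auto intro!: passage_sets)
    have "ennreal 1 \<le> emeasure M E"
    proof (rule tendsto_upperbound)
      show "(\<lambda>n. ennreal (passage_prob 0 (real m) (real (Suc n)))) \<longlonglongrightarrow> ennreal 1"
        by (intro tendsto_ennrealI passage_prob_no_drift_tendsto)
      show "\<forall>\<^sub>F n in sequentially. ennreal (passage_prob 0 (real m) (real (Suc n))) \<le> emeasure M E"
        using E by (intro always_eventually allI, subst emeasure_passage[symmetric])
          (auto intro!: emeasure_mono simp: E_def)
    qed simp
    then have "prob E = 1" using prob_le_1[of E] by (simp add: emeasure_eq_measure)
    then have "AE \<omega> in M. \<omega> \<in> E" using E AE_in_set_eq_1 by blast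
    then show "AE \<omega> in M. \<exists>s\<ge>0. real m < drifted 0 s \<omega>"
      by eventually_elim (auto simp: E_def passage_def)
  qed
  then show ?thesis
  proof eventually_elim
    fix \<omega> assume *: "\<forall>m::nat. \<exists>s\<ge>0. real m < drifted 0 s \<omega>"
    show "\<forall>c. \<exists>s\<ge>0. c < drifted \<gamma> s \<omega>"
    proof
      fix c
      obtain m where m: "c < real m" using reals_Archimedean2 by blast
      obtain s where s: "s \<ge> 0" "real m < drifted 0 s \<omega>" using * by blast
      have "drifted 0 s \<omega> \<le> drifted \<gamma> s \<omega>" using s \<gamma> by (simp add: drifted_def)
      then show "\<exists>s\<ge>0. c < drifted \<gamma> s \<omega>" using m s by (intro exI[of _ s]) auto
    qed
  qed
qed

section \<open>Law of the first-exit time\<close>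

lemma AE_first_exit_time_gt_iff:
  assumes \<delta>: "\<delta> > 0" and \<gamma>: "\<gamma> \<ge> 0" and t: "t \<ge> 0" and x: "x > 0"
  shows "AE \<omega> in M. x < first_exit_time (ig_subordinator B \<delta> \<gamma>) t \<omega> \<longleftrightarrow> \<omega> \<in> passage \<gamma> (\<delta> * x) t"
  using AE_drifted_unbounded[OF \<gamma>] BM_start AE_space
proof eventually_elim
  fix \<omega> assume unb: "\<forall>c. \<exists>s\<ge>0. c < drifted \<gamma> s \<omega>" and B0: "B 0 \<omega> = 0" and \<omega>: "\<omega> \<in> space M"
  let ?X = "\<lambda>s. B s \<omega> + \<gamma> * s"
  have X: "drifted \<gamma> s \<omega> = ?X s" for s by (simp add: drifted_def B0)
  have "x < Inf {u. 0 < u \<and> t < Inf {s. 0 < s \<and> \<delta> * u < ?X s}} \<longleftrightarrow> (\<exists>s\<in>{0..t}. \<delta> * x < ?X s)"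
  proof (rule first_exit_time_gt_iff[OF \<delta> _ _ _ t x])
    show "continuous_on {0..} ?X" by (intro continuous_intros BM_continuous[OF \<omega>])
    show "?X 0 = 0" by (simp add: B0)
    fix u :: real assume u: "u > 0"
    then obtain s where s: "s \<ge> 0" "\<delta> * u < ?X s" using unb X by metis
    moreover have "0 < \<delta> * u" using u \<delta> by simp
    ultimately have "s \<noteq> 0" using B0 by auto
    then show "\<exists>s>0. \<delta> * u < ?X s" using s by (intro exI[of _ s]) auto
  qed
  then show "x < first_exit_time (ig_subordinator B \<delta> \<gamma>) t \<omega> \<longleftrightarrow> \<omega> \<in> passage \<gamma> (\<delta> * x) t"
    unfolding first_exit_time_def ig_subordinator_def passage_def using \<omega> by (simp add: X)
qed

text \<open>The tail of H(t) is that of the running maximum at level \<delta> x; for t = 0 the running maximum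
  is 0, so the tail vanishes.\<close>
lemma emeasure_first_exit_time_gt:
  assumes \<delta>: "\<delta> > 0" and \<gamma>: "\<gamma> \<ge> 0" and t: "t \<ge> 0" and x: "x > 0"
    and H: "first_exit_time (ig_subordinator B \<delta> \<gamma>) t \<in> borel_measurable M"
  shows "emeasure M {\<omega>\<in>space M. first_exit_time (ig_subordinator B \<delta> \<gamma>) t \<omega> \<in> {x<..}}
    = ennreal (if t = 0 then 0 else passage_prob \<gamma> (\<delta> * x) t)"
proof -
  have ax: "\<delta> * x \<ge> 0" using \<delta> x by simp
  have "passage \<gamma> (\<delta> * x) t \<in> events"
    using passage_sets[OF _ \<gamma> ax, of t] passage_0[OF ax] t by (cases "t = 0") auto
  then have "emeasure M {\<omega>\<in>space M. first_exit_time (ig_subordinator B \<delta> \<gamma>) t \<omega> \<in> {x<..}} = emeasure M (passage \<gamma> (\<delta> * x) t)"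
    using AE_first_exit_time_gt_iff[OF \<delta> \<gamma> t x] H
    by (intro emeasure_eq_AE) (auto intro: AE_mp)
  also have "\<dots> = ennreal (if t = 0 then 0 else passage_prob \<gamma> (\<delta> * x) t)"
    using emeasure_passage[OF _ \<gamma> ax, of t] passage_0[OF ax] t by auto
  finally show ?thesis .
qed

end

section \<open>The density and its differential equation\<close>

text \<open>The normal density with mean \<gamma> t and variance t at m.\<close>
definition ig_kernel :: "real \<Rightarrow> real \<Rightarrow> real \<Rightarrow> real" where
  "ig_kernel \<gamma> m t = exp (- (m - \<gamma> * t)\<^sup>2 / (2 * t)) / sqrt (2 * pi * t)"

text \<open>The second summand of the passage probability.\<close>
definition tilted_tail :: "real \<Rightarrow> real \<Rightarrow> real \<Rightarrow> real" where
  "tilted_tail \<gamma> m t = exp (2 * \<gamma> * m) * gauss_tail ((m + \<gamma> * t) / sqrt t)"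

lemma ig_kernel_eq_std_normal:
  assumes t: "t > 0"
  shows "std_normal_density ((m - \<gamma> * t) / sqrt t) / sqrt t = ig_kernel \<gamma> m t"
  using t by (simp add: std_normal_density_def ig_kernel_def power_divide real_sqrt_mult)

text \<open>The exponential tilt turns the drift - \<gamma> into \<gamma>. For this reason the derivatives of the
  tilted tail lead back to the same kernel, and kernel and tilted tail together are closed under
  differentiation.\<close>
lemma ig_kernel_eq_tilted:
  assumes t: "t > 0"
  shows "exp (2 * \<gamma> * m) * std_normal_density ((m + \<gamma> * t) / sqrt t) / sqrt t = ig_kernel \<gamma> m t"
proof -
  have "2 * \<gamma> * m + - (m + \<gamma> * t)\<^sup>2 / (2 * t) = - (m - \<gamma> * t)\<^sup>2 / (2 * t)"
    using t by (simp add: divide_simps) (simp add: power2_eq_square algebra_simps)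
  then have "exp (2 * \<gamma> * m) * exp (- (m + \<gamma> * t)\<^sup>2 / (2 * t)) = exp (- (m - \<gamma> * t)\<^sup>2 / (2 * t))"
    by (simp only: exp_add[symmetric])
  moreover have "exp (2 * \<gamma> * m) * std_normal_density ((m + \<gamma> * t) / sqrt t) / sqrt t
     = exp (2 * \<gamma> * m) * exp (- (m + \<gamma> * t)\<^sup>2 / (2 * t)) / sqrt (2 * pi * t)"
    using t by (simp add: std_normal_density_def power_divide real_sqrt_mult)
  ultimately show ?thesis by (simp only: ig_kernel_def)
qed

lemma ig_kernel_deriv_space:
  assumes t: "t > 0"
  shows "((\<lambda>m. ig_kernel \<gamma> m t) has_real_derivative - (m - \<gamma> * t) / t * ig_kernel \<gamma> m t) (at m)"
proof -
  have "((\<lambda>m. - (m - \<gamma> * t)\<^sup>2) has_real_derivative - (2 * (m - \<gamma> * t))) (at m)"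
    by (rule derivative_eq_intros refl | simp)+
  then have "((\<lambda>m. - (m - \<gamma> * t)\<^sup>2 / (2 * t)) has_real_derivative - (2 * (m - \<gamma> * t)) / (2 * t)) (at m)"
    by (rule DERIV_cdivide)
  moreover have "- (2 * (m - \<gamma> * t)) / (2 * t) = - (m - \<gamma> * t) / t"
    using t by (simp add: field_simps)
  ultimately have "((\<lambda>m. - (m - \<gamma> * t)\<^sup>2 / (2 * t)) has_real_derivative - (m - \<gamma> * t) / t) (at m)"
    by (simp only:)
  from DERIV_cdivide[OF DERIV_fun_exp[OF this], of "sqrt (2 * pi * t)"] show ?thesis
    unfolding ig_kernel_def by (rule DERIV_cong) simp
qed

lemma ig_kernel_deriv_time:
  assumes t: "t > 0"
  shows "((\<lambda>t. ig_kernel \<gamma> m t) has_real_derivative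
     ig_kernel \<gamma> m t * (m\<^sup>2 / (2 * t\<^sup>2) - \<gamma>\<^sup>2 / 2 - 1 / (2 * t))) (at t)"
proof -
  have "((\<lambda>t. - (m - \<gamma> * t)\<^sup>2 / (2 * t)) has_real_derivative m\<^sup>2 / (2 * t\<^sup>2) - \<gamma>\<^sup>2 / 2) (at t)"
    using t by (auto intro!: derivative_eq_intros simp: divide_simps) (simp add: power2_eq_square algebra_simps)
  then have 1: "((\<lambda>t. exp (- (m - \<gamma> * t)\<^sup>2 / (2 * t))) has_real_derivative 
     exp (- (m - \<gamma> * t)\<^sup>2 / (2 * t)) * (m\<^sup>2 / (2 * t\<^sup>2) - \<gamma>\<^sup>2 / 2)) (at t)"
    by (rule DERIV_fun_exp)
  have 2: "((\<lambda>t. sqrt (2 * pi * t)) has_real_derivative sqrt (2 * pi * t) / (2 * t)) (at t)"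
    using t by (auto intro!: derivative_eq_intros simp: real_sqrt_mult field_simps)
  have nz: "sqrt (2 * pi * t) \<noteq> 0" using t by simp
  have alg: "(e * A * q - e * (q / (2 * t))) / (q * q) = e / q * (A - 1 / (2 * t))" if "q \<noteq> 0" for e A q :: real
    using that t by (simp add: field_simps)
  show ?thesis
    unfolding ig_kernel_def using DERIV_divide[OF 1 2 nz] alg[OF nz] by (simp only: diff_diff_eq)
qed

lemma tilted_tail_deriv_space:
  assumes t: "t > 0"
  shows "((\<lambda>m. tilted_tail \<gamma> m t) has_real_derivative 2 * \<gamma> * tilted_tail \<gamma> m t - ig_kernel \<gamma> m t) (at m)"
proof -
  have "((\<lambda>m. (m + \<gamma> * t) / sqrt t) has_real_derivative 1 / sqrt t) (at m)"
    by (intro DERIV_cdivide) (auto intro!: derivative_eq_intros)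
  then have "((\<lambda>m. gauss_tail ((m + \<gamma> * t) / sqrt t)) has_real_derivative
     - std_normal_density ((m + \<gamma> * t) / sqrt t) * (1 / sqrt t)) (at m)"
    by (rule DERIV_chain2[OF has_real_derivative_gauss_tail])
  moreover have "((\<lambda>m. exp (2 * \<gamma> * m)) has_real_derivative exp (2 * \<gamma> * m) * (2 * \<gamma>)) (at m)"
    by (auto intro!: derivative_eq_intros)
  ultimately have "((\<lambda>m. exp (2 * \<gamma> * m) * gauss_tail ((m + \<gamma> * t) / sqrt t)) has_real_derivative
     exp (2 * \<gamma> * m) * (2 * \<gamma>) * gauss_tail ((m + \<gamma> * t) / sqrt t)
     + - std_normal_density ((m + \<gamma> * t) / sqrt t) * (1 / sqrt t) * exp (2 * \<gamma> * m)) (at m)"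
    by (intro DERIV_mult)
  then show ?thesis
    unfolding tilted_tail_def ig_kernel_eq_tilted[OF t, symmetric]
    by (rule DERIV_cong) (simp add: algebra_simps)
qed

lemma tilted_tail_deriv_time:
  assumes t: "t > 0"
  shows "((\<lambda>t. tilted_tail \<gamma> m t) has_real_derivative ig_kernel \<gamma> m t * (m - \<gamma> * t) / (2 * t)) (at t)"
proof -
  have "((\<lambda>t. (m + \<gamma> * t) / sqrt t) has_real_derivative (\<gamma> * t - m) / (2 * t * sqrt t)) (at t)"
  proof -
    have "((\<lambda>t. m + \<gamma> * t) has_real_derivative \<gamma>) (at t)"
      by (auto intro!: derivative_eq_intros)
    from DERIV_divide[OF this DERIV_real_sqrt[OF t]]
    have "((\<lambda>t. (m + \<gamma> * t) / sqrt t) has_real_derivative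
        (\<gamma> * sqrt t - (m + \<gamma> * t) * (inverse (sqrt t) / 2)) / (sqrt t * sqrt t)) (at t)"
      using t by simp
    moreover have "(\<gamma> * q - (m + \<gamma> * (q * q)) * (inverse q / 2)) / (q * q) = (\<gamma> * (q * q) - m) / (2 * (q * q) * q)"
      if "q > 0" for q
      using that by (simp add: field_simps)
    from this[of "sqrt t"] have "(\<gamma> * sqrt t - (m + \<gamma> * t) * (inverse (sqrt t) / 2)) / (sqrt t * sqrt t)
        = (\<gamma> * t - m) / (2 * t * sqrt t)"
      using t by simp
    ultimately show ?thesis by (simp only:)
  qed
  then have "((\<lambda>t. gauss_tail ((m + \<gamma> * t) / sqrt t)) has_real_derivative
     - std_normal_density ((m + \<gamma> * t) / sqrt t) * ((\<gamma> * t - m) / (2 * t * sqrt t))) (at t)"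
    by (rule DERIV_chain2[OF has_real_derivative_gauss_tail])
  then have "((\<lambda>t. exp (2 * \<gamma> * m) * gauss_tail ((m + \<gamma> * t) / sqrt t)) has_real_derivative
     exp (2 * \<gamma> * m) * (- std_normal_density ((m + \<gamma> * t) / sqrt t) * ((\<gamma> * t - m) / (2 * t * sqrt t)))) (at t)"
    by (rule DERIV_cmult)
  then show ?thesis
    unfolding tilted_tail_def ig_kernel_eq_tilted[OF t, symmetric]
    by (rule DERIV_cong) (use t in \<open>simp add: field_simps\<close>)
qed

text \<open>The density at m of the running maximum at time t, followed by its first and second derivatives in m
  and its derivative in t, each written in terms of the kernel and the tilted tail.\<close>
definition hit_density :: "real \<Rightarrow> real \<Rightarrow> real \<Rightarrow> real" where
  "hit_density \<gamma> m t = 2 * ig_kernel \<gamma> m t - 2 * \<gamma> * tilted_tail \<gamma> m t"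
definition hit_density_m :: "real \<Rightarrow> real \<Rightarrow> real \<Rightarrow> real" where
  "hit_density_m \<gamma> m t = ig_kernel \<gamma> m t * (4 * \<gamma> - 2 * m / t) - 4 * \<gamma>\<^sup>2 * tilted_tail \<gamma> m t"
definition hit_density_mm :: "real \<Rightarrow> real \<Rightarrow> real \<Rightarrow> real" where
  "hit_density_mm \<gamma> m t = ig_kernel \<gamma> m t * (2 * m\<^sup>2 / t\<^sup>2 - 6 * \<gamma> * m / t - 2 / t + 8 * \<gamma>\<^sup>2) - 8 * \<gamma> ^ 3 * tilted_tail \<gamma> m t"
definition hit_density_t :: "real \<Rightarrow> real \<Rightarrow> real \<Rightarrow> real" where
  "hit_density_t \<gamma> m t = ig_kernel \<gamma> m t * (m\<^sup>2 / t\<^sup>2 - \<gamma> * m / t - 1 / t)"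

lemma hit_density_pde: 
  "hit_density_mm \<gamma> m t - 2 * \<gamma> * hit_density_m \<gamma> m t = 2 * hit_density_t \<gamma> m t"
  unfolding hit_density_m_def hit_density_mm_def hit_density_t_def
  by (simp add: algebra_simps power2_eq_square power3_eq_cube)

lemma passage_prob_deriv:
  assumes t: "t > 0"
  shows "((\<lambda>a. passage_prob \<gamma> a t) has_real_derivative - hit_density \<gamma> m t) (at m)"
proof -
  have "((\<lambda>m. (m - \<gamma> * t) / sqrt t) has_real_derivative 1 / sqrt t) (at m)"
    by (intro DERIV_cdivide) (auto intro!: derivative_eq_intros)
  then have "((\<lambda>m. gauss_tail ((m - \<gamma> * t) / sqrt t)) has_real_derivative
     - std_normal_density ((m - \<gamma> * t) / sqrt t) * (1 / sqrt t)) (at m)"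
    by (rule DERIV_chain2[OF has_real_derivative_gauss_tail])
  also have "- std_normal_density ((m - \<gamma> * t) / sqrt t) * (1 / sqrt t) = - ig_kernel \<gamma> m t"
    by (simp add: ig_kernel_eq_std_normal[OF t, symmetric])
  finally have "((\<lambda>m. gauss_tail ((m - \<gamma> * t) / sqrt t) + tilted_tail \<gamma> m t) has_real_derivative
     - ig_kernel \<gamma> m t + (2 * \<gamma> * tilted_tail \<gamma> m t - ig_kernel \<gamma> m t)) (at m)"
    by (intro DERIV_add tilted_tail_deriv_space t)
  then show ?thesis
    unfolding passage_prob_def tilted_tail_def[symmetric] hit_density_def
    by (rule DERIV_cong) simp
qed

lemma hit_density_deriv_space:
  assumes t: "t > 0"
  shows "((\<lambda>m. hit_density \<gamma> m t) has_real_derivative hit_density_m \<gamma> m t) (at m)"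
  unfolding hit_density_def hit_density_m_def using t
  by (auto intro!: derivative_eq_intros ig_kernel_deriv_space tilted_tail_deriv_space simp: field_simps power2_eq_square)

lemma hit_density_m_deriv_space:
  assumes t: "t > 0"
  shows "((\<lambda>m. hit_density_m \<gamma> m t) has_real_derivative hit_density_mm \<gamma> m t) (at m)"
proof -
  have 1: "((\<lambda>m. 4 * \<gamma> - 2 * m / t) has_real_derivative - (2 / t)) (at m)"
    using t by (auto intro!: derivative_eq_intros)
  have "((\<lambda>m. hit_density_m \<gamma> m t) has_real_derivative
     - (m - \<gamma> * t) / t * ig_kernel \<gamma> m t * (4 * \<gamma> - 2 * m / t) + - (2 / t) * ig_kernel \<gamma> m t
     - 4 * \<gamma>\<^sup>2 * (2 * \<gamma> * tilted_tail \<gamma> m t - ig_kernel \<gamma> m t)) (at m)"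
    unfolding hit_density_m_def
    by (intro DERIV_diff DERIV_mult DERIV_cmult ig_kernel_deriv_space[OF t] tilted_tail_deriv_space[OF t] 1)
  then show ?thesis
    by (rule DERIV_cong) (use t in \<open>simp add: hit_density_mm_def divide_simps\<close>, 
      simp add: power2_eq_square power3_eq_cube algebra_simps)
qed

lemma hit_density_deriv_time:
  assumes t: "t > 0"
  shows "((\<lambda>t. hit_density \<gamma> m t) has_real_derivative hit_density_t \<gamma> m t) (at t)"
proof -
  have "((\<lambda>t. hit_density \<gamma> m t) has_real_derivative
     2 * (ig_kernel \<gamma> m t * (m\<^sup>2 / (2 * t\<^sup>2) - \<gamma>\<^sup>2 / 2 - 1 / (2 * t)))
     - 2 * \<gamma> * (ig_kernel \<gamma> m t * (m - \<gamma> * t) / (2 * t))) (at t)"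
    unfolding hit_density_def
    by (intro DERIV_diff DERIV_cmult ig_kernel_deriv_time[OF t] tilted_tail_deriv_time[OF t])
  then show ?thesis
    by (rule DERIV_cong) (use t in \<open>simp add: hit_density_t_def divide_simps\<close>, 
      simp add: power2_eq_square algebra_simps)
qed

text \<open>Near t = 0 the factor exp(- m^2 / (2 t)) dominates every power of t; the exponent 2 is the largest
  power of 1 / t that multiplies the kernel in the derivatives of the density.\<close>
lemma ig_kernel_bound:
  assumes m: "m > 0" and \<gamma>: "\<gamma> \<ge> 0"
  obtains C where "C \<ge> 0" "\<And>t. t > 0 \<Longrightarrow> ig_kernel \<gamma> m t \<le> C * t\<^sup>2" "\<And>t. t > 0 \<Longrightarrow> ig_kernel \<gamma> m t \<le> C"
proof -
  define c where "c = m\<^sup>2 / 2"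
  have c: "c > 0" using m by (simp add: c_def)
  \<comment> \<open>The first summand serves t \<le> 1, through exp(c / t) \<ge> (c / (3 t))^3, and the second one t > 1.\<close>
  define C where "C = exp (\<gamma> * m) * (27 / c ^ 3 + 1)"
  have C: "C \<ge> 0" using c by (simp add: C_def)
  have k: "ig_kernel \<gamma> m t \<le> exp (\<gamma> * m) * (exp (- (c / t)) / sqrt t)" if t: "t > 0" for t
  proof -
    have "- (m - \<gamma> * t)\<^sup>2 / (2 * t) = \<gamma> * m + - (c / t) - \<gamma>\<^sup>2 * t / 2"
      using t by (simp add: c_def divide_simps) (simp add: power2_eq_square algebra_simps)
    also have "\<dots> \<le> \<gamma> * m + - (c / t)" using t by simp
    finally have "exp (- (m - \<gamma> * t)\<^sup>2 / (2 * t)) \<le> exp (\<gamma> * m) * exp (- (c / t))"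
      by (simp only: exp_add[symmetric] exp_le_cancel_iff)
    moreover have "sqrt t \<le> sqrt (2 * pi * t)"
      using t pi_ge_two by (intro real_sqrt_le_mono) (simp add: mult_le_cancel_right1)
    ultimately have "ig_kernel \<gamma> m t \<le> exp (\<gamma> * m) * exp (- (c / t)) / sqrt t"
      unfolding ig_kernel_def using t by (intro frac_le) auto
    then show ?thesis by simp
  qed
  have le: "ig_kernel \<gamma> m t \<le> (if t \<le> 1 then C * t\<^sup>2 else C)" if t: "t > 0" for t
  proof (cases "t \<le> 1")
    case True
    have "(1 + (c / t) / real 3) ^ 3 \<le> exp (c / t)"
      using c t by (intro exp_ge_one_plus_x_over_n_power_n) (auto intro: order_trans[of _ 0])
    moreover have "((c / t) / 3) ^ 3 \<le> (1 + (c / t) / real 3) ^ 3"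
      using c t by (intro power_mono) auto
    ultimately have "((c / t) / 3) ^ 3 \<le> exp (c / t)" by linarith
    then have "exp (- (c / t)) \<le> 1 / ((c / t) / 3) ^ 3"
      using c t by (simp add: exp_minus field_simps)
    also have "\<dots> = 27 / c ^ 3 * t ^ 3" using c t by (simp add: field_simps power3_eq_cube)
    finally have e: "exp (- (c / t)) \<le> 27 / c ^ 3 * t ^ 3" .
    have "t \<le> sqrt t" using t True by (intro real_le_rsqrt) (simp add: power2_eq_square mult_left_le)
    then have "exp (- (c / t)) / sqrt t \<le> 27 / c ^ 3 * t ^ 3 / t"
      using e c t by (intro frac_le) auto
    also have "\<dots> = 27 / c ^ 3 * t\<^sup>2" using t by (simp add: power2_eq_square power3_eq_cube)
    also have "\<dots> \<le> (27 / c ^ 3 + 1) * t\<^sup>2" by (intro mult_right_mono) auto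
    finally have "exp (\<gamma> * m) * (exp (- (c / t)) / sqrt t) \<le> exp (\<gamma> * m) * ((27 / c ^ 3 + 1) * t\<^sup>2)"
      by (intro mult_left_mono) auto
    then show ?thesis using k[OF t] True unfolding C_def by (simp add: mult.assoc)
  next
    case False
    have "exp (- (c / t)) / sqrt t \<le> 1 / 1"
      using c t False by (intro frac_le) auto
    also have "\<dots> \<le> 27 / c ^ 3 + 1" using c by simp
    finally have "exp (\<gamma> * m) * (exp (- (c / t)) / sqrt t) \<le> C"
      unfolding C_def by (intro mult_left_mono) auto
    then show ?thesis using k[OF t] False by simp
  qed
  show thesis
  proof (rule that[OF C])
    fix t :: real assume t: "t > 0"
    show "ig_kernel \<gamma> m t \<le> C * t\<^sup>2"
    proof (cases "t \<le> 1")
      case False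
      then have "C * 1 \<le> C * t\<^sup>2" using C by (intro mult_left_mono) (auto intro: one_le_power)
      then show ?thesis using le[OF t] False by simp
    qed (use le[OF t] in simp)
    show "ig_kernel \<gamma> m t \<le> C"
    proof (cases "t \<le> 1")
      case True
      then have "C * t\<^sup>2 \<le> C * 1" using C t by (intro mult_left_mono) (auto intro: power_le_one)
      then show ?thesis using le[OF t] True by simp
    qed (use le[OF t] in simp)
  qed
qed

lemma ig_kernel_nonneg: "0 \<le> ig_kernel \<gamma> m t" if "t > 0"
  using that by (simp add: ig_kernel_def)

lemma tilted_tail_nonneg: "0 \<le> tilted_tail \<gamma> m t"
  by (simp add: tilted_tail_def gauss_tail_nonneg)

lemma tilted_tail_le: "tilted_tail \<gamma> m t \<le> exp (2 * \<gamma> * m)"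
  unfolding tilted_tail_def using gauss_tail_le_1 mult_left_mono[of _ 1 "exp (2 * \<gamma> * m)"] by fastforce

lemma kernel_combination_bounded:
  assumes m: "m > 0" and \<gamma>: "\<gamma> \<ge> 0"
  shows "\<exists>K. \<forall>t>0. \<bar>ig_kernel \<gamma> m t * (p + q / t + r / t\<^sup>2) + b * tilted_tail \<gamma> m t\<bar> \<le> K"
proof -
  obtain C where C: "C \<ge> 0" "\<And>t. t > 0 \<Longrightarrow> ig_kernel \<gamma> m t \<le> C * t\<^sup>2" "\<And>t. t > 0 \<Longrightarrow> ig_kernel \<gamma> m t \<le> C"
    using ig_kernel_bound[OF m \<gamma>] by blast
  have "\<bar>ig_kernel \<gamma> m t * (p + q / t + r / t\<^sup>2) + b * tilted_tail \<gamma> m t\<bar>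
     \<le> C * \<bar>p\<bar> + C * \<bar>q\<bar> + C * \<bar>r\<bar> + \<bar>b\<bar> * exp (2 * \<gamma> * m)" if t: "t > 0" for t
  proof -
    let ?k = "ig_kernel \<gamma> m t"
    have k0: "0 \<le> ?k" using t by (rule ig_kernel_nonneg)
    have k2: "?k / t\<^sup>2 \<le> C" using C(2)[OF t] t by (simp add: divide_le_eq)
    have k1: "?k / t \<le> C"
    proof (cases "t \<le> 1")
      case True
      have "?k / t \<le> C * t\<^sup>2 / t" using C(2)[OF t] t by (intro divide_right_mono) auto
      also have "\<dots> = C * t" using t by (simp add: power2_eq_square)
      also have "\<dots> \<le> C" using True C(1) by (simp add: mult_left_le)
      finally show ?thesis .
    next
      case False
      then have "?k / t \<le> ?k / 1" using k0 by (intro divide_left_mono) auto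
      then show ?thesis using C(3)[OF t] by simp
    qed
    have "\<bar>?k * (p + q / t + r / t\<^sup>2) + b * tilted_tail \<gamma> m t\<bar>
       = \<bar>?k * p + ?k / t * q + ?k / t\<^sup>2 * r + b * tilted_tail \<gamma> m t\<bar>"
      by (simp add: algebra_simps)
    also have "\<dots> \<le> \<bar>?k * p\<bar> + \<bar>?k / t * q\<bar> + \<bar>?k / t\<^sup>2 * r\<bar> + \<bar>b * tilted_tail \<gamma> m t\<bar>"
      by linarith
    also have "\<dots> = ?k * \<bar>p\<bar> + ?k / t * \<bar>q\<bar> + ?k / t\<^sup>2 * \<bar>r\<bar> + \<bar>b\<bar> * tilted_tail \<gamma> m t"
      using k0 t tilted_tail_nonneg by (simp add: abs_mult)
    also have "\<dots> \<le> C * \<bar>p\<bar> + C * \<bar>q\<bar> + C * \<bar>r\<bar> + \<bar>b\<bar> * exp (2 * \<gamma> * m)"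
      by (intro add_mono mult_right_mono mult_left_mono C(3)[OF t] k1 k2 tilted_tail_le) auto
    finally show ?thesis .
  qed
  then show ?thesis by blast
qed

lemma hit_density_bounded:
  assumes "m > 0" "\<gamma> \<ge> 0"
  shows "\<exists>K. \<forall>t>0. \<bar>hit_density \<gamma> m t\<bar> \<le> K" "\<exists>K. \<forall>t>0. \<bar>hit_density_m \<gamma> m t\<bar> \<le> K"
    "\<exists>K. \<forall>t>0. \<bar>hit_density_mm \<gamma> m t\<bar> \<le> K" "\<exists>K. \<forall>t>0. \<bar>hit_density_t \<gamma> m t\<bar> \<le> K"
proof -
  show "\<exists>K. \<forall>t>0. \<bar>hit_density \<gamma> m t\<bar> \<le> K"
    using kernel_combination_bounded[OF assms, of 2 0 0 "- 2 * \<gamma>"] by (simp add: hit_density_def mult.commute)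
  show "\<exists>K. \<forall>t>0. \<bar>hit_density_m \<gamma> m t\<bar> \<le> K"
    using kernel_combination_bounded[OF assms, of "4 * \<gamma>" "- 2 * m" 0 "- 4 * \<gamma>\<^sup>2"] by (simp add: hit_density_m_def)
  have "hit_density_mm \<gamma> m t = ig_kernel \<gamma> m t * (8 * \<gamma>\<^sup>2 + (- 6 * \<gamma> * m - 2) / t + 2 * m\<^sup>2 / t\<^sup>2) + (- 8 * \<gamma> ^ 3) * tilted_tail \<gamma> m t" for t
    by (simp add: hit_density_mm_def diff_divide_distrib algebra_simps)
  then show "\<exists>K. \<forall>t>0. \<bar>hit_density_mm \<gamma> m t\<bar> \<le> K"
    using kernel_combination_bounded[OF assms, of "8 * \<gamma>\<^sup>2" "- 6 * \<gamma> * m - 2" "2 * m\<^sup>2" "- 8 * \<gamma> ^ 3"] by simp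
  have "hit_density_t \<gamma> m t = ig_kernel \<gamma> m t * (0 + (- \<gamma> * m - 1) / t + m\<^sup>2 / t\<^sup>2) + 0 * tilted_tail \<gamma> m t" for t
    by (simp add: hit_density_t_def diff_divide_distrib algebra_simps)
  then show "\<exists>K. \<forall>t>0. \<bar>hit_density_t \<gamma> m t\<bar> \<le> K"
    using kernel_combination_bounded[OF assms, of 0 "- \<gamma> * m - 1" "m\<^sup>2" 0] by simp
qed

lemma hit_density_continuous:
  "continuous_on {0<..} (hit_density \<gamma> m)" "continuous_on {0<..} (hit_density_m \<gamma> m)"
  "continuous_on {0<..} (hit_density_mm \<gamma> m)" "continuous_on {0<..} (hit_density_t \<gamma> m)"
proof -
  have 1: "continuous_on {0<..} (\<lambda>t. ig_kernel \<gamma> m t)"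
    by (intro DERIV_continuous_on[where D="\<lambda>t. ig_kernel \<gamma> m t * (m\<^sup>2 / (2 * t\<^sup>2) - \<gamma>\<^sup>2 / 2 - 1 / (2 * t))"])
       (auto intro!: has_field_derivative_at_within ig_kernel_deriv_time)
  have 2: "continuous_on {0<..} (\<lambda>t. tilted_tail \<gamma> m t)"
    by (intro DERIV_continuous_on[where D="\<lambda>t. ig_kernel \<gamma> m t * (m - \<gamma> * t) / (2 * t)"])
       (auto intro!: has_field_derivative_at_within tilted_tail_deriv_time)
  note [continuous_intros] = 1 2
  show "continuous_on {0<..} (hit_density \<gamma> m)" "continuous_on {0<..} (hit_density_m \<gamma> m)"
  "continuous_on {0<..} (hit_density_mm \<gamma> m)" "continuous_on {0<..} (hit_density_t \<gamma> m)"
    unfolding hit_density_def[abs_def] hit_density_m_def[abs_def] hit_density_mm_def[abs_def] hit_density_t_def[abs_def]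
    by (intro continuous_intros; simp)+
qed

lemma hit_density_tendsto_0:
  assumes m: "m > 0" and \<gamma>: "\<gamma> \<ge> 0"
  shows "(hit_density \<gamma> m \<longlongrightarrow> 0) (at_right 0)"
proof -
  obtain C where C: "C \<ge> 0" "\<And>t. t > 0 \<Longrightarrow> ig_kernel \<gamma> m t \<le> C * t\<^sup>2" "\<And>t. t > 0 \<Longrightarrow> ig_kernel \<gamma> m t \<le> C"
    using ig_kernel_bound[OF m \<gamma>] by blast
  have k: "((\<lambda>t. ig_kernel \<gamma> m t) \<longlongrightarrow> 0) (at_right 0)"
  proof (rule tendsto_sandwich[where f="\<lambda>_. 0" and h="\<lambda>t. C * t\<^sup>2"])
    have "((\<lambda>t. C * t\<^sup>2) \<longlongrightarrow> C * 0\<^sup>2) (at_right 0)" by (intro tendsto_intros)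
    then show "((\<lambda>t. C * t\<^sup>2) \<longlongrightarrow> 0) (at_right 0)" by simp
    show "\<forall>\<^sub>F t in at_right 0. 0 \<le> ig_kernel \<gamma> m t"
      using eventually_at_right_less[of "0::real"] by (rule eventually_mono) (rule ig_kernel_nonneg)
    show "\<forall>\<^sub>F t in at_right 0. ig_kernel \<gamma> m t \<le> C * t\<^sup>2"
      using eventually_at_right_less[of "0::real"] by (rule eventually_mono) (rule C(2))
  qed simp
  have "filterlim (\<lambda>t. (m + \<gamma> * t) / sqrt t) at_top (at_right 0)"
  proof (rule filterlim_at_top_mono)
    have "(sqrt \<longlongrightarrow> sqrt 0) (at_right 0)" by (intro tendsto_intros)
    then have "filterlim (\<lambda>t. inverse (sqrt t)) at_top (at_right 0)"
      using eventually_at_right_less[of "0::real"]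
      by (intro filterlim_inverse_at_top) (auto elim: eventually_mono)
    from filterlim_tendsto_pos_mult_at_top[OF tendsto_const m this]
    show "filterlim (\<lambda>t. m / sqrt t) at_top (at_right 0)" by (simp add: divide_inverse)
    show "\<forall>\<^sub>F t in at_right 0. m / sqrt t \<le> (m + \<gamma> * t) / sqrt t"
      using eventually_at_right_less[of "0::real"]
    proof (rule eventually_mono)
      fix t :: real assume "0 < t"
      then show "m / sqrt t \<le> (m + \<gamma> * t) / sqrt t" using \<gamma> by (intro divide_right_mono) auto
    qed
  qed
  then have "((\<lambda>t. gauss_tail ((m + \<gamma> * t) / sqrt t)) \<longlongrightarrow> 0) (at_right 0)"
    by (rule filterlim_compose[OF gauss_tail_at_top])
  from tendsto_mult_left[OF this, of "exp (2 * \<gamma> * m)"]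
  have e: "((\<lambda>t. tilted_tail \<gamma> m t) \<longlongrightarrow> 0) (at_right 0)"
    unfolding tilted_tail_def by simp
  show ?thesis
    unfolding hit_density_def[abs_def]
    using tendsto_diff[OF tendsto_mult_left[OF k, of 2] tendsto_mult_left[OF e, of "2 * \<gamma>"]] by simp
qed

section \<open>Recovering a continuous density from its tail\<close>

text \<open>The tail determines the integral of f over every bounded interval away from 0, and the fundamental
  theorem of calculus recovers f at every point because f is continuous.\<close>
lemma continuous_density_eq_neg_deriv:
  assumes f: "has_continuous_density_pos M X f"
    and tail: "\<And>x. x > 0 \<Longrightarrow> emeasure M {\<omega>\<in>space M. X \<omega> \<in> {x<..}} = ennreal (F x)"
    and nonneg: "\<And>x. x > 0 \<Longrightarrow> 0 \<le> F x"
    and x: "x > 0" and deriv: "(F has_real_derivative D) (at x)"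
  shows "f x = - D"
proof -
  have cont: "continuous_on {0<..} f" and f0: "\<And>y. y > 0 \<Longrightarrow> 0 \<le> f y"
    and dens: "\<And>A. A \<in> sets borel \<Longrightarrow> A \<subseteq> {0<..} \<Longrightarrow>
        emeasure M {\<omega>\<in>space M. X \<omega> \<in> A} = (\<integral>\<^sup>+x\<in>A. ennreal (f x) \<partial>lborel)"
    using f unfolding has_continuous_density_pos_def by auto
  \<comment> \<open>A point strictly between 0 and x, because f need not be continuous at 0.\<close>
  define c where "c = x / 2"
  have c: "c > 0" "c < x" using x by (auto simp: c_def)
  have contc: "continuous_on {c..y} f" for y
    by (rule continuous_on_subset[OF cont]) (use c in auto)
  have split: "F y = F c - integral {c..y} f" if y: "y > c" for y
  proof -
    have f_meas: "(\<lambda>z. ennreal (f z) * indicator {c<..y} z) \<in> borel_measurable borel"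
      "(\<lambda>z. ennreal (f z) * indicator {y<..} z) \<in> borel_measurable borel"
    proof -
      \<comment> \<open>The values of f on the negative half-line are arbitrary, so measurability holds only after restriction.\<close>
      have "(\<lambda>z. indicator {0<..} z *\<^sub>R f z) \<in> borel_measurable borel"
        by (rule borel_measurable_continuous_on_indicator[OF _ cont]) simp
      then have [measurable]: "(\<lambda>z. ennreal (indicator {0<..} z *\<^sub>R f z)) \<in> borel_measurable borel" by simp
      have "(\<lambda>z. ennreal (indicator {0<..} z *\<^sub>R f z) * indicator {c<..y} z) \<in> borel_measurable borel"
        "(\<lambda>z. ennreal (indicator {0<..} z *\<^sub>R f z) * indicator {y<..} z) \<in> borel_measurable borel"
        by measurable
      moreover have "(\<lambda>z. ennreal (indicator {0<..} z *\<^sub>R f z) * indicator {c<..y} z) = (\<lambda>z. ennreal (f z) * indicator {c<..y} z)"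
        "(\<lambda>z. ennreal (indicator {0<..} z *\<^sub>R f z) * indicator {y<..} z) = (\<lambda>z. ennreal (f z) * indicator {y<..} z)"
        using c y by (auto simp: fun_eq_iff indicator_def)
      ultimately show "(\<lambda>z. ennreal (f z) * indicator {c<..y} z) \<in> borel_measurable borel"
        "(\<lambda>z. ennreal (f z) * indicator {y<..} z) \<in> borel_measurable borel" by auto
    qed
    have "ennreal (F c) = (\<integral>\<^sup>+z\<in>{c<..}. ennreal (f z) \<partial>lborel)"
      using tail[OF c(1)] dens[of "{c<..}"] c by (simp add: subset_iff)
    also have "\<dots> = (\<integral>\<^sup>+z. ennreal (f z) * indicator {c<..y} z + ennreal (f z) * indicator {y<..} z \<partial>lborel)"
      using y by (intro nn_integral_cong) (auto simp: indicator_def)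
    also have "\<dots> = (\<integral>\<^sup>+z\<in>{c<..y}. ennreal (f z) \<partial>lborel) + (\<integral>\<^sup>+z\<in>{y<..}. ennreal (f z) \<partial>lborel)"
      using f_meas by (intro nn_integral_add) auto
    also have "(\<integral>\<^sup>+z\<in>{y<..}. ennreal (f z) \<partial>lborel) = ennreal (F y)"
      using tail[of y] dens[of "{y<..}"] c y by (simp add: subset_iff)
    also have "(\<integral>\<^sup>+z\<in>{c<..y}. ennreal (f z) \<partial>lborel) = (\<integral>\<^sup>+z. ennreal (indicator {c..y} z *\<^sub>R f z) \<partial>lborel)"
      using AE_lborel_singleton[of c] c f0
      by (intro nn_integral_cong_AE) (auto simp: indicator_def)
    also have "\<dots> = ennreal (LBINT z:{c..y}. f z)"
      unfolding set_lebesgue_integral_def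
      using borel_integrable_atLeastAtMost'[OF contc[of y]] c f0
      by (intro nn_integral_eq_integral) (auto simp: set_integrable_def indicator_def)
    also have "(LBINT z:{c..y}. f z) = integral {c..y} f"
      by (rule set_borel_integral_eq_integral) (rule borel_integrable_atLeastAtMost'[OF contc])
    finally have eq: "ennreal (F c) = ennreal (integral {c..y} f) + ennreal (F y)" .
    have i0: "0 \<le> integral {c..y} f"
      using c f0 by (intro integral_nonneg integrable_continuous_interval contc) auto
    have "F c = integral {c..y} f + F y"
      using eq i0 nonneg[of y] nonneg[OF c(1)] c y
      by (metis add_nonneg_nonneg ennreal_inj ennreal_plus less_trans)
    then show ?thesis by simp
  qed
  have "((\<lambda>y. integral {c..y} f) has_real_derivative f x) (at x within {c..x + 1})"
    by (rule integral_has_real_derivative[OF contc]) (use c in auto)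
  then have "((\<lambda>y. integral {c..y} f) has_real_derivative f x) (at x)"
    using c by (simp add: at_within_Icc_at)
  then have "((\<lambda>y. F c - integral {c..y} f) has_real_derivative 0 - f x) (at x)"
    by (intro DERIV_diff DERIV_const)
  moreover have "eventually (\<lambda>y. y \<in> {c<..}) (nhds x)"
    using c by (intro eventually_nhds_in_open) auto
  then have "eventually (\<lambda>y. F y = F c - integral {c..y} f) (nhds x)"
    by eventually_elim (rule split, auto)
  ultimately have "(F has_real_derivative - f x) (at x)"
    by (subst DERIV_cong_ev[OF refl _ refl]) auto
  then show ?thesis using DERIV_unique[OF deriv] by simp
qed

section \<open>Laplace transforms\<close>

lemma set_integrable_exp_decay:
  assumes s: "s > (0::real)"
  shows "set_integrable lborel {0..} (\<lambda>t. exp (- s * t))"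
proof -
  have "(\<lambda>t. exp (- s * t)) absolutely_integrable_on {0..}"
    by (intro nonnegative_absolutely_integrable_1 integrable_on_exp_minus_to_infinity s) auto
  then show ?thesis
    unfolding set_integrable_def
    by (subst integrable_completion[symmetric]) (auto intro: borel_measurable_continuous_onI continuous_intros)
qed

lemma laplace_integrand_integrable:
  fixes w :: "real \<Rightarrow> real"
  assumes s: "s > 0" and cont: "continuous_on {0<..} w" and bound: "\<And>t. t > 0 \<Longrightarrow> \<bar>w t\<bar> \<le> K"
  shows "set_integrable lborel {0<..} (\<lambda>t. exp (- s * t) * w t)"
proof (rule set_integrable_bound)
  show "set_integrable lborel {0<..} (\<lambda>t. K * exp (- s * t))"
    by (intro set_integrable_mult_right set_integrable_subset[OF set_integrable_exp_decay[OF s]]) auto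
  have "continuous_on {0<..} (\<lambda>t. exp (- s * t) * w t)"
    by (intro continuous_intros cont)
  then have "(\<lambda>t. indicat_real {0<..} t *\<^sub>R (exp (- s * t) * w t)) \<in> borel_measurable borel"
    by (rule borel_measurable_continuous_on_indicator[rotated]) simp
  then show "set_borel_measurable lborel {0<..} (\<lambda>t. exp (- s * t) * w t)"
    unfolding set_borel_measurable_def by simp
  show "AE t in lborel. t \<in> {0<..} \<longrightarrow> norm (exp (- s * t) * w t) \<le> norm (K * exp (- s * t))"
  proof (intro always_eventually allI impI)
    fix t :: real assume "t \<in> {0<..}"
    then have "\<bar>w t\<bar> \<le> \<bar>K\<bar>" using bound[of t] by auto
    then show "norm (exp (- s * t) * w t) \<le> norm (K * exp (- s * t))"
      by (simp add: abs_mult)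
  qed
qed

text \<open>Derivatives in t at the boundary point 0 have no meaningful value, so the analysis takes place on
  the open half-line; a single point does not affect the transform.\<close>
lemma
  fixes w :: "real \<Rightarrow> real"
  assumes "set_integrable lborel {0<..} (\<lambda>t. exp (- s * t) * w t)"
  shows laplace_convergesI: "laplace_converges w s"
    and laplace_eq_open: "laplace w s = (LBINT t:{0<..}. exp (- s * t) * w t)"
proof -
  have Un: "{0..} = {0::real} \<union> {0<..}" by auto
  have 0: "set_integrable lborel {0} (\<lambda>t. exp (- s * t) * w t)"
  proof -
    have "(\<lambda>t. indicat_real {0} t *\<^sub>R (exp (- s * t) * w t)) = (\<lambda>t. indicat_real {0} t *\<^sub>R w 0)"
      by (auto simp: fun_eq_iff indicator_def)
    then show ?thesis unfolding set_integrable_def by simp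
  qed
  show "laplace_converges w s"
    unfolding laplace_converges_def Un by (intro set_integrable_Un 0 assms) auto
  have "(LBINT t:{0}. exp (- s * t) * w t) = (LBINT (t::real). indicat_real {0} t *\<^sub>R w 0)"
    unfolding set_lebesgue_integral_def by (intro Bochner_Integration.integral_cong) (auto simp: indicator_def)
  then have "(LBINT t:{0}. exp (- s * t) * w t) = 0" by simp
  then show "laplace w s = (LBINT t:{0<..}. exp (- s * t) * w t)"
    unfolding laplace_def Un by (subst set_integral_Un[OF _ 0 assms]) auto
qed

text \<open>Integration by parts: f is the derivative of exp(- s t) w(t), whose limits at 0 and at infinity are
  w0 and 0.\<close>
lemma laplace_of_derivative:
  fixes w w' :: "real \<Rightarrow> real"
  assumes s: "s > 0"
    and deriv: "\<And>t. t > 0 \<Longrightarrow> (w has_real_derivative w' t) (at t)"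
    and cont': "continuous_on {0<..} w'"
    and bound: "\<And>t. t > 0 \<Longrightarrow> \<bar>w t\<bar> \<le> K" and bound': "\<And>t. t > 0 \<Longrightarrow> \<bar>w' t\<bar> \<le> K'"
    and lim: "(w \<longlongrightarrow> w0) (at_right 0)"
  shows "laplace w' s = s * laplace w s - w0"
proof -
  have cont: "continuous_on {0<..} w"
    by (rule DERIV_continuous_on) (auto intro: has_field_derivative_at_within deriv)
  note i = laplace_integrand_integrable[OF s cont bound] and i' = laplace_integrand_integrable[OF s cont' bound']
  define f where "f t = exp (- s * t) * w' t - s * (exp (- s * t) * w t)" for t
  have si: "set_integrable lborel {0<..} (\<lambda>t. s * (exp (- s * t) * w t))"
    by (intro set_integrable_mult_right i)
  have f_int: "set_integrable lborel {0<..} f"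
    unfolding f_def by (intro set_integral_diff i' si)
  have "(LBINT t=0..\<infinity>. f t) = 0 - w0"
  proof (rule interval_integral_FTC_integrable[where F="\<lambda>t. exp (- s * t) * w t"])
    show "((\<lambda>t. exp (- s * t) * w t) has_vector_derivative f t) (at t)" if "0 < ereal t" for t
    proof -
      have "((\<lambda>t. exp (- s * t)) has_real_derivative exp (- s * t) * (- s)) (at t)"
        by (auto intro!: derivative_eq_intros)
      from DERIV_mult[OF this deriv[of t]] that
      have "((\<lambda>t. exp (- s * t) * w t) has_real_derivative f t) (at t)"
        by (simp add: f_def algebra_simps)
      then show ?thesis by (simp add: has_real_derivative_iff_has_vector_derivative)
    qed
    show "isCont f t" if "0 < ereal t" for t
    proof -
      have "continuous_on {0<..} f"
        unfolding f_def by (intro continuous_intros cont cont')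
      then show ?thesis using that by (simp add: continuous_on_eq_continuous_at)
    qed
    have "einterval 0 \<infinity> = {0::real<..}" by (auto simp: einterval_def)
    then show "set_integrable lborel (einterval 0 \<infinity>) f" using f_int by simp
    have "((\<lambda>t. exp (- s * t) * w t) \<longlongrightarrow> exp (- s * 0) * w0) (at_right 0)"
      by (intro tendsto_intros lim)
    then have "((\<lambda>t. exp (- s * t) * w t) \<longlongrightarrow> w0) (at_right 0)" by simp
    then show "(((\<lambda>t. exp (- s * t) * w t) \<circ> real_of_ereal) \<longlongrightarrow> w0) (at_right 0)"
      unfolding zero_ereal_def ereal_tendsto_simps1 .
    have "((\<lambda>t. exp (- s * t) * w t) \<longlongrightarrow> 0) at_top"
    proof (rule tendsto_rabs_zero_cancel, rule tendsto_sandwich[where f="\<lambda>_. 0" and h="\<lambda>t. exp (- s * t) * K"])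
      show "((\<lambda>t. exp (- s * t) * K) \<longlongrightarrow> 0) at_top" using s by real_asymp
      show "\<forall>\<^sub>F t in at_top. \<bar>exp (- s * t) * w t\<bar> \<le> exp (- s * t) * K"
        using eventually_gt_at_top[of "0::real"]
        by (rule eventually_mono) (simp add: abs_mult bound)
    qed auto
    then show "(((\<lambda>t. exp (- s * t) * w t) \<circ> real_of_ereal) \<longlongrightarrow> 0) (at_left \<infinity>)"
      unfolding ereal_tendsto_simps1 .
  qed simp
  then have "(LBINT t:{0<..}. f t) = - w0"
    by (simp add: interval_lebesgue_integral_0_infty)
  moreover have "(LBINT t:{0<..}. f t) = laplace w' s - s * laplace w s"
  proof -
    have "(LBINT t:{0<..}. f t) = (LBINT t:{0<..}. exp (- s * t) * w' t) - (LBINT t:{0<..}. s * (exp (- s * t) * w t))"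
      unfolding f_def by (rule set_integral_diff(2)[OF i' si])
    also have "(LBINT t:{0<..}. s * (exp (- s * t) * w t)) = s * (LBINT t:{0<..}. exp (- s * t) * w t)"
      by (rule set_integral_mult_right)
    also have "(LBINT t:{0<..}. exp (- s * t) * w t) = laplace w s"
      by (rule laplace_eq_open[OF i, symmetric])
    also have "(LBINT t:{0<..}. exp (- s * t) * w' t) = laplace w' s"
      by (rule laplace_eq_open[OF i', symmetric])
    finally show ?thesis .
  qed
  ultimately show ?thesis by simp
qed

section \<open>The governing equation of the first-exit time\<close>

theorem theorem3p1:
  fixes M :: "'a measure" and B G H :: "real \<Rightarrow> 'a \<Rightarrow> real"
    and \<delta> \<gamma> :: real and h :: "real \<Rightarrow> real \<Rightarrow> real"
  assumes BM: "standard_brownian_motion M B"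
    and \<delta>: "\<delta> > 0" and \<gamma>: "\<gamma> \<ge> 0"
    and G: "G = ig_subordinator B \<delta> \<gamma>"
    and H: "H = first_exit_time G"
    and h: "\<And>t. t \<ge> 0 \<Longrightarrow> has_continuous_density_pos M (H t) (\<lambda>x. h x t)"
  shows
    "(\<forall>x>0. \<forall>t>0.
        (\<lambda>y. h y t) differentiable (at x) \<and>
        (\<lambda>y. partial_x h y t) differentiable (at x) \<and>
        (\<lambda>u. h x u) differentiable (at t) \<and>
        partial_x (partial_x h) x t - 2 * \<delta> * \<gamma> * partial_x h x t = 2 * \<delta>\<^sup>2 * partial_t h x t) \<and>
     (\<forall>x>0. \<forall>s>0.
        laplace_converges (h x) s \<and>
        laplace_converges (partial_x h x) s \<and>
        laplace_converges (partial_x (partial_x h) x) s \<and>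
        laplace_converges (partial_t h x) s \<and>
        laplace (partial_t h x) s = s * laplace (h x) s - h x 0 \<and>
        laplace (partial_x (partial_x h) x) s - 2 * \<delta> * \<gamma> * laplace (partial_x h x) s
          = 2 * \<delta>\<^sup>2 * laplace (partial_t h x) s + 2 * \<delta>\<^sup>2 * h x 0 * laplace_dirac0 s)"
proof -
  interpret standard_brownian_motion M B by (rule BM)
  have H_meas: "H t \<in> borel_measurable M" if "t \<ge> 0" for t
    using h[OF that] by (simp add: has_continuous_density_pos_def)
  have survival: "emeasure M {\<omega>\<in>space M. H t \<omega> \<in> {x<..}} = ennreal (if t = 0 then 0 else passage_prob \<gamma> (\<delta> * x) t)"
    if "t \<ge> 0" "x > 0" for t x
    using emeasure_first_exit_time_gt[OF \<delta> \<gamma> that] H_meas[OF that(1)] by (simp add: H G)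
  \<comment> \<open>The formulas for h hold on the open quadrant, and every derivative below is taken at an interior
    point, where agreement in a neighbourhood suffices.\<close>
  have h_eq: "h x t = \<delta> * hit_density \<gamma> (\<delta> * x) t" if x: "x > 0" and t: "t > 0" for x t
  proof -
    have "((\<lambda>x. passage_prob \<gamma> (\<delta> * x) t) has_real_derivative - hit_density \<gamma> (\<delta> * x) t * \<delta>) (at x)"
      by (rule DERIV_chain2[OF passage_prob_deriv[OF t]]) (auto intro!: derivative_eq_intros)
    from continuous_density_eq_neg_deriv[OF h _ _ x this] survival t show ?thesis
      by (simp add: passage_prob_def gauss_tail_nonneg)
  qed
  \<comment> \<open>At time 0 the tail of H vanishes identically, and so does the continuous density.\<close>
  have h0: "h x 0 = 0" if x: "x > 0" for x
    using continuous_density_eq_neg_deriv[OF h, of 0 "\<lambda>_. 0" x 0] survival x by simp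
  have near: "eventually (\<lambda>y. 0 < y) (nhds x)" if "x > 0" for x :: real
    using eventually_nhds_in_open[of "{0<..}" x] that by simp
  have hx: "((\<lambda>y. h y t) has_real_derivative \<delta>\<^sup>2 * hit_density_m \<gamma> (\<delta> * x) t) (at x)"
    if x: "x > 0" and t: "t > 0" for x t
  proof -
    have "((\<lambda>y. hit_density \<gamma> (\<delta> * y) t) has_real_derivative hit_density_m \<gamma> (\<delta> * x) t * \<delta>) (at x)"
      by (rule DERIV_chain2[OF hit_density_deriv_space[OF t]]) (auto intro!: derivative_eq_intros)
    from DERIV_cmult[OF this, of \<delta>]
    have "((\<lambda>y. \<delta> * hit_density \<gamma> (\<delta> * y) t) has_real_derivative \<delta>\<^sup>2 * hit_density_m \<gamma> (\<delta> * x) t) (at x)"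
      by (simp add: power2_eq_square mult_ac)
    moreover have "eventually (\<lambda>y. h y t = \<delta> * hit_density \<gamma> (\<delta> * y) t) (nhds x)"
      using near[OF x] by eventually_elim (rule h_eq[OF _ t])
    ultimately show ?thesis by (subst DERIV_cong_ev[OF refl _ refl]) auto
  qed
  then have px: "partial_x h x t = \<delta>\<^sup>2 * hit_density_m \<gamma> (\<delta> * x) t" if "x > 0" "t > 0" for x t
    unfolding partial_x_def using that by (intro DERIV_imp_deriv) auto
  have hxx: "((\<lambda>y. partial_x h y t) has_real_derivative \<delta> ^ 3 * hit_density_mm \<gamma> (\<delta> * x) t) (at x)"
    if x: "x > 0" and t: "t > 0" for x t
  proof -
    have "((\<lambda>y. hit_density_m \<gamma> (\<delta> * y) t) has_real_derivative hit_density_mm \<gamma> (\<delta> * x) t * \<delta>) (at x)"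
      by (rule DERIV_chain2[OF hit_density_m_deriv_space[OF t]]) (auto intro!: derivative_eq_intros)
    from DERIV_cmult[OF this, of "\<delta>\<^sup>2"]
    have "((\<lambda>y. \<delta>\<^sup>2 * hit_density_m \<gamma> (\<delta> * y) t) has_real_derivative \<delta> ^ 3 * hit_density_mm \<gamma> (\<delta> * x) t) (at x)"
      by (simp add: power2_eq_square power3_eq_cube mult_ac)
    moreover have "eventually (\<lambda>y. partial_x h y t = \<delta>\<^sup>2 * hit_density_m \<gamma> (\<delta> * y) t) (nhds x)"
      using near[OF x] by eventually_elim (rule px[OF _ t])
    ultimately show ?thesis by (subst DERIV_cong_ev[OF refl _ refl]) auto
  qed
  then have pxx: "partial_x (partial_x h) x t = \<delta> ^ 3 * hit_density_mm \<gamma> (\<delta> * x) t" if "x > 0" "t > 0" for x t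
    unfolding partial_x_def[of "partial_x h"] using that by (intro DERIV_imp_deriv) auto
  have ht: "(h x has_real_derivative \<delta> * hit_density_t \<gamma> (\<delta> * x) t) (at t)"
    if x: "x > 0" and t: "t > 0" for x t
  proof -
    have "((\<lambda>u. \<delta> * hit_density \<gamma> (\<delta> * x) u) has_real_derivative \<delta> * hit_density_t \<gamma> (\<delta> * x) t) (at t)"
      by (rule DERIV_cmult[OF hit_density_deriv_time[OF t]])
    moreover have "eventually (\<lambda>u. h x u = \<delta> * hit_density \<gamma> (\<delta> * x) u) (nhds t)"
      using near[OF t] by eventually_elim (rule h_eq[OF x])
    ultimately show ?thesis by (subst DERIV_cong_ev[OF refl _ refl]) auto
  qed
  then have pt: "partial_t h x t = \<delta> * hit_density_t \<gamma> (\<delta> * x) t" if "x > 0" "t > 0" for x t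
    unfolding partial_t_def using that by (intro DERIV_imp_deriv) auto
  have pde: "partial_x (partial_x h) x t - 2 * \<delta> * \<gamma> * partial_x h x t = 2 * \<delta>\<^sup>2 * partial_t h x t"
    if "x > 0" "t > 0" for x t
  proof -
    have "partial_x (partial_x h) x t - 2 * \<delta> * \<gamma> * partial_x h x t
       = \<delta> ^ 3 * (hit_density_mm \<gamma> (\<delta> * x) t - 2 * \<gamma> * hit_density_m \<gamma> (\<delta> * x) t)"
      by (simp add: px[OF that] pxx[OF that] power2_eq_square power3_eq_cube algebra_simps)
    also have "\<dots> = 2 * \<delta>\<^sup>2 * partial_t h x t"
      by (simp only: hit_density_pde) (simp add: pt[OF that] power2_eq_square power3_eq_cube)
    finally show ?thesis .
  qed
  have pointwise: "(\<lambda>y. h y t) differentiable (at x) \<and>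
        (\<lambda>y. partial_x h y t) differentiable (at x) \<and>
        (\<lambda>u. h x u) differentiable (at t) \<and>
        partial_x (partial_x h) x t - 2 * \<delta> * \<gamma> * partial_x h x t = 2 * \<delta>\<^sup>2 * partial_t h x t"
    if "x > 0" "t > 0" for x t
    using hx[OF that] hxx[OF that] ht[OF that] pde[OF that] real_differentiable_def by blast
  have transform: "laplace_converges (h x) s \<and>
        laplace_converges (partial_x h x) s \<and>
        laplace_converges (partial_x (partial_x h) x) s \<and>
        laplace_converges (partial_t h x) s \<and>
        laplace (partial_t h x) s = s * laplace (h x) s - h x 0 \<and>
        laplace (partial_x (partial_x h) x) s - 2 * \<delta> * \<gamma> * laplace (partial_x h x) s
          = 2 * \<delta>\<^sup>2 * laplace (partial_t h x) s + 2 * \<delta>\<^sup>2 * h x 0 * laplace_dirac0 s"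
    if x: "x > 0" and s: "s > 0" for x s
  proof -
    have m: "\<delta> * x > 0" using \<delta> x by simp
    have scaled: "continuous_on {0<..} w \<and> (\<exists>K. \<forall>t>0. \<bar>w t\<bar> \<le> K)"
      if eq: "\<And>t. t > 0 \<Longrightarrow> w t = a * g t" and g: "continuous_on {0<..} g" and bd: "\<exists>K. \<forall>t>0. \<bar>g t\<bar> \<le> K"
      for w g :: "real \<Rightarrow> real" and a
    proof
      have "continuous_on {0<..} (\<lambda>t. a * g t)" by (intro continuous_intros g)
      then show "continuous_on {0<..} w" by (rule continuous_on_cong[THEN iffD1, rotated -1]) (auto simp: eq)
      obtain K where "\<And>t. t > 0 \<Longrightarrow> \<bar>g t\<bar> \<le> K" using bd by blast
      then have "\<bar>w t\<bar> \<le> \<bar>a\<bar> * K" if "t > 0" for t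
        using that by (simp add: eq abs_mult mult_left_mono)
      then show "\<exists>K. \<forall>t>0. \<bar>w t\<bar> \<le> K" by blast
    qed
    \<comment> \<open>All four functions are multiples of combinations of kernel and tilted tail, at the point \<delta> x > 0.\<close>
    obtain K Kx Kxx Kt where bounds:
      "\<And>t. t > 0 \<Longrightarrow> \<bar>h x t\<bar> \<le> K" "\<And>t. t > 0 \<Longrightarrow> \<bar>partial_x h x t\<bar> \<le> Kx"
      "\<And>t. t > 0 \<Longrightarrow> \<bar>partial_x (partial_x h) x t\<bar> \<le> Kxx" "\<And>t. t > 0 \<Longrightarrow> \<bar>partial_t h x t\<bar> \<le> Kt"
      and conts: "continuous_on {0<..} (h x)" "continuous_on {0<..} (partial_x h x)"
      "continuous_on {0<..} (partial_x (partial_x h) x)" "continuous_on {0<..} (partial_t h x)"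
      using scaled[OF h_eq[OF x] hit_density_continuous(1) hit_density_bounded(1)[OF m \<gamma>]]
        scaled[OF px[OF x] hit_density_continuous(2) hit_density_bounded(2)[OF m \<gamma>]]
        scaled[OF pxx[OF x] hit_density_continuous(3) hit_density_bounded(3)[OF m \<gamma>]]
        scaled[OF pt[OF x] hit_density_continuous(4) hit_density_bounded(4)[OF m \<gamma>]]
      by metis
    note ints = laplace_integrand_integrable[OF s conts(1) bounds(1)] laplace_integrand_integrable[OF s conts(2) bounds(2)]
      laplace_integrand_integrable[OF s conts(3) bounds(3)] laplace_integrand_integrable[OF s conts(4) bounds(4)]
    have "((\<lambda>t. \<delta> * hit_density \<gamma> (\<delta> * x) t) \<longlongrightarrow> \<delta> * 0) (at_right 0)"
      by (intro tendsto_mult_left hit_density_tendsto_0 m \<gamma>)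
    moreover have "\<forall>\<^sub>F t in at_right 0. \<delta> * hit_density \<gamma> (\<delta> * x) t = h x t"
      using eventually_at_right_less[of "0::real"] by (rule eventually_mono) (simp add: h_eq[OF x])
    ultimately have "(h x \<longlongrightarrow> 0) (at_right 0)" using Lim_transform_eventually by fastforce
    then have time: "laplace (partial_t h x) s = s * laplace (h x) s - h x 0"
      unfolding h0[OF x]
      by (intro laplace_of_derivative[OF s _ conts(4) bounds(1,4)]) (simp_all add: pt[OF x] ht[OF x])
    note open_eqs = ints[THEN laplace_eq_open]
    have "laplace (partial_x (partial_x h) x) s - 2 * \<delta> * \<gamma> * laplace (partial_x h x) s
       = (LBINT t:{0<..}. exp (- s * t) * partial_x (partial_x h) x t)
         - (LBINT t:{0<..}. 2 * \<delta> * \<gamma> * (exp (- s * t) * partial_x h x t))"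
      by (simp only: open_eqs set_integral_mult_right)
    also have "\<dots> = (LBINT t:{0<..}. exp (- s * t) * partial_x (partial_x h) x t - 2 * \<delta> * \<gamma> * (exp (- s * t) * partial_x h x t))"
      by (intro set_integral_diff(2)[symmetric] set_integrable_mult_right ints)
    also have "\<dots> = (LBINT t:{0<..}. 2 * \<delta>\<^sup>2 * (exp (- s * t) * partial_t h x t))"
    proof (intro set_lebesgue_integral_cong allI impI)
      fix t :: real assume "t \<in> {0<..}"
      then have "exp (- s * t) * (partial_x (partial_x h) x t - 2 * \<delta> * \<gamma> * partial_x h x t) = exp (- s * t) * (2 * \<delta>\<^sup>2 * partial_t h x t)"
        using pde[OF x] by simp
      then show "exp (- s * t) * partial_x (partial_x h) x t - 2 * \<delta> * \<gamma> * (exp (- s * t) * partial_x h x t)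
         = 2 * \<delta>\<^sup>2 * (exp (- s * t) * partial_t h x t)"
        by (simp only: right_diff_distrib mult_ac)
    qed simp
    also have "\<dots> = 2 * \<delta>\<^sup>2 * laplace (partial_t h x) s"
      by (simp only: open_eqs set_integral_mult_right)
    finally have "laplace (partial_x (partial_x h) x) s - 2 * \<delta> * \<gamma> * laplace (partial_x h x) s
        = 2 * \<delta>\<^sup>2 * laplace (partial_t h x) s + 2 * \<delta>\<^sup>2 * h x 0 * laplace_dirac0 s"
      by (simp add: h0[OF x])
    with time ints show ?thesis by (auto intro: laplace_convergesI)
  qed
  show ?thesis using pointwise transform by blast
qed

end
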